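(* For every position $X$, there is an isomorphism of categories $\mathcal S_X\cong\prod_{(n,x)\in\mathrm{Pl}(X)}\mathcal S_{[n]}$, where $\mathrm{Pl}(X)=\sum_{n}X([n])$ is the set of pairs $(n,x)$ with $x$ a player of $X$ knowing $n$ channels, and $[n]$ denotes the position given by the representable presheaf on $[n]$.
   Context: Base category. Let $\mathcal C$ be the category generated by the following graph modulo relations. Objects: $\star$; $[n]$ for each $n\in\mathbb N$; for each $n$: $\mathrm{tick}_n,\mathrm{paral}_n,\mathrm{parar}_n,\nu_n,\mathrm{para}_n$; for each $n$ and $1\le i\le n$: $\iota^+_{n,i},\iota^-_{n,i}$; for all $n,m$, $1\le i\le n$, $1\le j\le m$: $\tau_{n,i,m,j}$. Generating arrows: $d_1,\dots,d_n\colon\star\to[n]$; $s,t\colon[n]\to c$ for $c\in\{\mathrm{tick}_n,\mathrm{paral}_n,\mathrm{parar}_n,\iota^+_{n,i},\iota^-_{n,i}\}$; $s\colon[n]\to\nu_n$ and $t\colon[n+1]\to\nu_n$; $l\colon\mathrm{paral}_n\to\mathrm{para}_n$, $r\colon\mathrm{parar}_n\to\mathrm{para}_n$; $\epsilon\colon\iota^+_{n,i}\to\tau_{n,i,m,j}$, $\rho\colon\iota^-_{m,j}\to\tau_{n,i,m,j}$. Relations: $s\circ d_i=t\circ d_i$ for each pair $s,t$ into one object (sources $[n]$, resp. $[n],[n+1]$ for $\nu_n$) and $1\le i\le n$; $l\circ s=r\circ s$; $\epsilon\circ s\circ d_i=\rho\circ s\circ d_j$ in $\tau_{n,i,m,j}$.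 Let $\widehat{\mathcal C}=[\mathcal C^{op},\mathbf{Set}]$, objects of $\mathcal C$ identified with representables. A position is a finite presheaf on $\mathcal C$ empty on all objects other than $\star$ and the $[n]$; elements over $\star$ are channels, elements over $[n]$ are players knowing $n$ channels. Basic moves: for $c\in\{\mathrm{tick}_n,\mathrm{paral}_n,\mathrm{parar}_n,\nu_n,\iota^\pm_{n,i}\}$, the cospan $[n]\xrightarrow{s}c\xleftarrow{t}[n']$ ($n'=n+1$ for $\nu_n$, else $n'=n$), with interface $n\cdot\star$ mapped into $[n]$ and $[n']$ by $[d_1,\dots,d_n]$ (and any isomorphic cospan). An extended move is obtained from a move $A\to M\leftarrow B$ with interface $I$ and a morphism $I\to Z$ to a position $Z$ by pushing out $A,M,B$ along $I\to Z$. A play is a mono $X_0\hookrightarrow U$ in $\widehat{\mathcal C}$ with $U$ the colimit of a finite or countable chain $X_0\to M_0\leftarrow X_1\to M_1\leftarrow\cdots$ of extended moves. A view is a play $[n]\hookrightarrow V$ from a finite (possibly empty) chain of extended basic moves. $\mathcal E_X$: objects are plays $Y\hookrightarrow U$ with a morphism $Y\to X$; morphisms are pairs $(h\colon Y\to Y',k\colon U\to U')$ commuting with the inclusions and the maps to $X$. $\mathcal V_X\subseteq\mathcal E_X$ is the full subcategory of views, and $\mathcal S_X=[\mathcal V_X^{op},\mathbf{Set}]$ is the category of innocent strategies on $X$. *)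

theory Defs
  imports "HOL-Library.FuncSet" "HOL-Library.Extended_Nat"
begin

section \<open>Categories\<close>

record ('o, 'm) cat =
  Ob :: "'o set"
  Ar :: "'m set"
  Dom :: "'m \<Rightarrow> 'o"
  Cod :: "'m \<Rightarrow> 'o"
  Idn :: "'o \<Rightarrow> 'm"
  Comp :: "'m \<Rightarrow> 'm \<Rightarrow> 'm"  \<comment> \<open>\<open>Comp K g f\<close> is \<open>g\<close> after \<open>f\<close>\<close>

definition hom :: "('o, 'm) cat \<Rightarrow> 'o \<Rightarrow> 'o \<Rightarrow> 'm set" where
  "hom K a b = {f \<in> Ar K. Dom K f = a \<and> Cod K f = b}"

locale category =
  fixes K :: "('o, 'm) cat"
  assumes dom_Ob: "f \<in> Ar K \<Longrightarrow> Dom K f \<in> Ob K"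
    and cod_Ob: "f \<in> Ar K \<Longrightarrow> Cod K f \<in> Ob K"
    and idn_hom: "a \<in> Ob K \<Longrightarrow> Idn K a \<in> hom K a a"
    and comp_hom: "f \<in> hom K a b \<Longrightarrow> g \<in> hom K b c \<Longrightarrow> Comp K g f \<in> hom K a c"
    and comp_idn_right: "f \<in> hom K a b \<Longrightarrow> Comp K f (Idn K a) = f"
    and comp_idn_left: "f \<in> hom K a b \<Longrightarrow> Comp K (Idn K b) f = f"
    and comp_assoc: "f \<in> hom K a b \<Longrightarrow> g \<in> hom K b c \<Longrightarrow> h \<in> hom K c d \<Longrightarrow>
      Comp K h (Comp K g f) = Comp K (Comp K h g) f"

definition op_cat :: "('o, 'm) cat \<Rightarrow> ('o, 'm) cat" where
  "op_cat K = \<lparr>Ob = Ob K, Ar = Ar K, Dom = Cod K, Cod = Dom K, Idn = Idn K,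
     Comp = (\<lambda>g f. Comp K f g)\<rparr>"

definition full_subcat :: "('o, 'm) cat \<Rightarrow> 'o set \<Rightarrow> ('o, 'm) cat" where
  "full_subcat K S = \<lparr>Ob = Ob K \<inter> S,
     Ar = {f \<in> Ar K. Dom K f \<in> S \<and> Cod K f \<in> S},
     Dom = Dom K, Cod = Cod K, Idn = Idn K, Comp = Comp K\<rparr>"

definition product_cat :: "'i set \<Rightarrow> ('i \<Rightarrow> ('o, 'm) cat) \<Rightarrow> ('i \<Rightarrow> 'o, 'i \<Rightarrow> 'm) cat" where
  "product_cat I D = \<lparr>Ob = (\<Pi>\<^sub>E i\<in>I. Ob (D i)), Ar = (\<Pi>\<^sub>E i\<in>I. Ar (D i)),
     Dom = (\<lambda>f. \<lambda>i\<in>I. Dom (D i) (f i)), Cod = (\<lambda>f. \<lambda>i\<in>I. Cod (D i) (f i)),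
     Idn = (\<lambda>a. \<lambda>i\<in>I. Idn (D i) (a i)),
     Comp = (\<lambda>g f. \<lambda>i\<in>I. Comp (D i) (g i) (f i))\<rparr>"

text \<open>Functors and natural transformations are extensional outside the carriers of their
  source, so that equality of functors is HOL equality.\<close>

datatype ('o, 'm, 'p, 'q) fctr = Fctr (onO: "'o \<Rightarrow> 'p") (onA: "'m \<Rightarrow> 'q")

definition is_functor :: "('o, 'm) cat \<Rightarrow> ('p, 'q) cat \<Rightarrow> ('o, 'm, 'p, 'q) fctr \<Rightarrow> bool" where
  "is_functor K L F \<longleftrightarrow>
     onO F \<in> Ob K \<rightarrow>\<^sub>E Ob L \<and> onA F \<in> Ar K \<rightarrow>\<^sub>E Ar L \<and>
     (\<forall>f\<in>Ar K. onA F f \<in> hom L (onO F (Dom K f)) (onO F (Cod K f))) \<and>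
     (\<forall>a\<in>Ob K. onA F (Idn K a) = Idn L (onO F a)) \<and>
     (\<forall>f\<in>Ar K. \<forall>g\<in>Ar K. Dom K g = Cod K f \<longrightarrow>
        onA F (Comp K g f) = Comp L (onA F g) (onA F f))"

definition isomorphic_categories :: "('o, 'm) cat \<Rightarrow> ('p, 'q) cat \<Rightarrow> bool" where
  "isomorphic_categories K L \<longleftrightarrow> category K \<and> category L \<and>
     (\<exists>F G. is_functor K L F \<and> is_functor L K G \<and>
        (\<forall>a\<in>Ob K. onO G (onO F a) = a) \<and> (\<forall>f\<in>Ar K. onA G (onA F f) = f) \<and>
        (\<forall>b\<in>Ob L. onO F (onO G b) = b) \<and> (\<forall>g\<in>Ar L. onA F (onA G g) = g))"

datatype ('f, 'o, 'q) ntrans = NTrans (nsrc: 'f) (ntgt: 'f) (ncmp: "'o \<Rightarrow> 'q")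

definition is_ntrans ::
  "('o, 'm) cat \<Rightarrow> ('p, 'q) cat \<Rightarrow> (('o, 'm, 'p, 'q) fctr, 'o, 'q) ntrans \<Rightarrow> bool" where
  "is_ntrans K L t \<longleftrightarrow>
     is_functor K L (nsrc t) \<and> is_functor K L (ntgt t) \<and>
     ncmp t \<in> extensional (Ob K) \<and>
     (\<forall>a\<in>Ob K. ncmp t a \<in> hom L (onO (nsrc t) a) (onO (ntgt t) a)) \<and>
     (\<forall>f\<in>Ar K. Comp L (ncmp t (Cod K f)) (onA (nsrc t) f) =
                Comp L (onA (ntgt t) f) (ncmp t (Dom K f)))"

definition functor_cat :: "('o, 'm) cat \<Rightarrow> ('p, 'q) cat \<Rightarrow>
    (('o, 'm, 'p, 'q) fctr, (('o, 'm, 'p, 'q) fctr, 'o, 'q) ntrans) cat" where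
  "functor_cat K L = \<lparr>Ob = {F. is_functor K L F}, Ar = {t. is_ntrans K L t},
     Dom = nsrc, Cod = ntgt,
     Idn = (\<lambda>F. NTrans F F (\<lambda>a\<in>Ob K. Idn L (onO F a))),
     Comp = (\<lambda>t s. NTrans (nsrc s) (ntgt t) (\<lambda>a\<in>Ob K. Comp L (ncmp t a) (ncmp s a)))\<rparr>"

text \<open>The sets with elements in the type \<open>'a\<close> play the role of the small sets;
  \<open>'a\<close> is a type variable throughout.\<close>

datatype 'a set_arr = SetArr (sdom: "'a set") (scod: "'a set") (sfun: "'a \<Rightarrow> 'a")

definition set_cat :: "('a set, 'a set_arr) cat" where
  "set_cat = \<lparr>Ob = UNIV, Ar = {f. sfun f \<in> sdom f \<rightarrow>\<^sub>E scod f},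
     Dom = sdom, Cod = scod,
     Idn = (\<lambda>A. SetArr A A (\<lambda>x\<in>A. x)),
     Comp = (\<lambda>g f. SetArr (sdom f) (scod g) (compose (sdom f) (sfun g) (sfun f)))\<rparr>"

type_synonym ('o, 'm, 'a) presheaf = "('o, 'm, 'a set, 'a set_arr) fctr"
type_synonym ('o, 'm, 'a) presheaf_arr = "(('o, 'm, 'a) presheaf, 'o, 'a set_arr) ntrans"

definition presheaf_cat ::
  "('o, 'm) cat \<Rightarrow> (('o, 'm, 'a) presheaf, ('o, 'm, 'a) presheaf_arr) cat" where
  "presheaf_cat K = functor_cat (op_cat K) set_cat"

text \<open>For representables to be presheaves, the elements have to comprise the arrows of the
  base category; hence the element type \<open>'m + 'u\<close> with \<open>'u\<close> arbitrary.\<close>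

definition yo :: "('o, 'm) cat \<Rightarrow> 'o \<Rightarrow> ('o, 'm, 'm + 'u) presheaf" where
  "yo K a = Fctr (\<lambda>c\<in>Ob K. Inl ` hom K c a)
     (\<lambda>f\<in>Ar K. SetArr (Inl ` hom K (Cod K f) a) (Inl ` hom K (Dom K f) a)
        (\<lambda>x\<in>Inl ` hom K (Cod K f) a. Inl (Comp K (projl x) f)))"

definition yo_arr :: "('o, 'm) cat \<Rightarrow> 'm \<Rightarrow> ('o, 'm, 'm + 'u) presheaf_arr" where
  "yo_arr K f = NTrans (yo K (Dom K f)) (yo K (Cod K f))
     (\<lambda>c\<in>Ob K. SetArr (Inl ` hom K c (Dom K f)) (Inl ` hom K c (Cod K f))
        (\<lambda>x\<in>Inl ` hom K c (Dom K f). Inl (Comp K f (projl x))))"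


section \<open>Monos, isos and colimits\<close>

definition is_mono :: "('o, 'm) cat \<Rightarrow> 'm \<Rightarrow> bool" where
  "is_mono K u \<longleftrightarrow> u \<in> Ar K \<and>
     (\<forall>a. \<forall>g\<in>hom K a (Dom K u). \<forall>h\<in>hom K a (Dom K u). Comp K u g = Comp K u h \<longrightarrow> g = h)"

definition is_iso :: "('o, 'm) cat \<Rightarrow> 'm \<Rightarrow> bool" where
  "is_iso K f \<longleftrightarrow> f \<in> Ar K \<and>
     (\<exists>g\<in>hom K (Cod K f) (Dom K f).
        Comp K g f = Idn K (Dom K f) \<and> Comp K f g = Idn K (Cod K f))"

text \<open>A diagram has vertices \<open>J\<close>, objects \<open>D\<close> and labelled edges \<open>(i, f, j)\<close> with
  \<open>f : D i \<rightarrow> D j\<close>.\<close>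

definition is_cocone ::
  "('o, 'm) cat \<Rightarrow> 'j set \<Rightarrow> ('j \<Rightarrow> 'o) \<Rightarrow> ('j \<times> 'm \<times> 'j) set \<Rightarrow> 'o \<Rightarrow> ('j \<Rightarrow> 'm) \<Rightarrow> bool" where
  "is_cocone K J D E P c \<longleftrightarrow> P \<in> Ob K \<and> (\<forall>j\<in>J. c j \<in> hom K (D j) P) \<and>
     (\<forall>(i, f, j)\<in>E. Comp K (c j) f = c i)"

definition is_colimit ::
  "('o, 'm) cat \<Rightarrow> 'j set \<Rightarrow> ('j \<Rightarrow> 'o) \<Rightarrow> ('j \<times> 'm \<times> 'j) set \<Rightarrow> 'o \<Rightarrow> ('j \<Rightarrow> 'm) \<Rightarrow> bool" where
  "is_colimit K J D E P c \<longleftrightarrow> is_cocone K J D E P c \<and>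
     (\<forall>Q e. is_cocone K J D E Q e \<longrightarrow>
        (\<exists>!h. h \<in> hom K P Q \<and> (\<forall>j\<in>J. Comp K h (c j) = e j)))"

definition is_coproduct ::
  "('o, 'm) cat \<Rightarrow> 'j set \<Rightarrow> ('j \<Rightarrow> 'o) \<Rightarrow> 'o \<Rightarrow> ('j \<Rightarrow> 'm) \<Rightarrow> bool" where
  "is_coproduct K J D P c \<longleftrightarrow> is_colimit K J D {} P c"

text \<open>\<open>is_pushout K f g p q\<close>: the square \<open>p \<circ> f = q \<circ> g\<close> is a pushout of the span \<open>f, g\<close>.\<close>

definition is_pushout :: "('o, 'm) cat \<Rightarrow> 'm \<Rightarrow> 'm \<Rightarrow> 'm \<Rightarrow> 'm \<Rightarrow> bool" where
  "is_pushout K f g p q \<longleftrightarrow>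
     f \<in> Ar K \<and> g \<in> Ar K \<and> Dom K f = Dom K g \<and>
     p \<in> hom K (Cod K f) (Cod K p) \<and> q \<in> hom K (Cod K g) (Cod K p) \<and>
     Comp K p f = Comp K q g \<and>
     (\<forall>Q. \<forall>p'\<in>hom K (Cod K f) Q. \<forall>q'\<in>hom K (Cod K g) Q. Comp K p' f = Comp K q' g \<longrightarrow>
        (\<exists>!h. h \<in> hom K (Cod K p) Q \<and> Comp K h p = p' \<and> Comp K h q = q'))"


section \<open>The category presented by a graph and relations\<close>

text \<open>Paths are listed in diagrammatic order: the first edge of the list is the first one
  traversed.\<close>

record ('v, 'e) graph =
  verts :: "'v set"
  edges :: "'e set"
  esrc :: "'e \<Rightarrow> 'v"
  etgt :: "'e \<Rightarrow> 'v"

fun is_path :: "('v, 'e) graph \<Rightarrow> 'v \<Rightarrow> 'e list \<Rightarrow> 'v \<Rightarrow> bool" where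
  "is_path G a [] b \<longleftrightarrow> a \<in> verts G \<and> a = b"
| "is_path G a (e # es) b \<longleftrightarrow>
     a \<in> verts G \<and> e \<in> edges G \<and> esrc G e = a \<and> is_path G (etgt G e) es b"

inductive path_cong ::
  "('v, 'e) graph \<Rightarrow> ('e list \<times> 'e list) set \<Rightarrow> 'v \<Rightarrow> 'v \<Rightarrow> 'e list \<Rightarrow> 'e list \<Rightarrow> bool"
  for G :: "('v, 'e) graph" and R :: "('e list \<times> 'e list) set"
where
  rel: "(p, q) \<in> R \<Longrightarrow> is_path G a p b \<Longrightarrow> is_path G a q b \<Longrightarrow> path_cong G R a b p q"
| refl: "is_path G a p b \<Longrightarrow> path_cong G R a b p p"
| sym: "path_cong G R a b p q \<Longrightarrow> path_cong G R a b q p"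
| trans: "path_cong G R a b p q \<Longrightarrow> path_cong G R a b q r \<Longrightarrow> path_cong G R a b p r"
| append: "path_cong G R a b p q \<Longrightarrow> path_cong G R b c p' q' \<Longrightarrow>
    path_cong G R a c (p @ p') (q @ q')"

definition path_class ::
  "('v, 'e) graph \<Rightarrow> ('e list \<times> 'e list) set \<Rightarrow> 'v \<Rightarrow> 'v \<Rightarrow> 'e list \<Rightarrow> 'v \<times> 'v \<times> 'e list set" where
  "path_class G R a b p = (a, b, {q. path_cong G R a b p q})"

definition presented_cat ::
  "('v, 'e) graph \<Rightarrow> ('e list \<times> 'e list) set \<Rightarrow> ('v, 'v \<times> 'v \<times> 'e list set) cat" where
  "presented_cat G R = \<lparr>Ob = verts G,
     Ar = {path_class G R a b p | a b p. is_path G a p b},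
     Dom = (\<lambda>(a, b, P). a), Cod = (\<lambda>(a, b, P). b),
     Idn = (\<lambda>a. path_class G R a a []),
     Comp = (\<lambda>(b', c, Q) (a, b, P).
       (a, c, {r. \<exists>p\<in>P. \<exists>q\<in>Q. path_cong G R a c (p @ q) r}))\<rparr>"

definition gen_arr ::
  "('v, 'e) graph \<Rightarrow> ('e list \<times> 'e list) set \<Rightarrow> 'e \<Rightarrow> 'v \<times> 'v \<times> 'e list set" where
  "gen_arr G R e = path_class G R (esrc G e) (etgt G e) [e]"


section \<open>The base category\<close>

datatype cobj =
    Star
  | Player nat
  | Tick nat
  | ParaL nat
  | ParaR nat
  | Nu nat
  | Para nat
  | IotaP nat nat
  | IotaM nat nat
  | Tau nat nat nat nat

datatype cedge =
    Ed nat nat             \<comment> \<open>\<open>Ed n i\<close> is \<open>d\<^sub>i : \<star> \<rightarrow> [n]\<close>\<close>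
  | Es cobj
  | Et cobj
  | El nat
  | Er nat
  | Eeps nat nat nat nat
  | Erho nat nat nat nat

definition basic_objs :: "cobj set" where
  "basic_objs = range Tick \<union> range ParaL \<union> range ParaR \<union> range Nu \<union>
     {IotaP n i | n i. 1 \<le> i \<and> i \<le> n} \<union> {IotaM n i | n i. 1 \<le> i \<and> i \<le> n}"

text \<open>For \<open>c \<in> basic_objs\<close>, \<open>s : [ar_s c] \<rightarrow> c\<close> and \<open>t : [ar_t c] \<rightarrow> c\<close>.\<close>

fun ar_s :: "cobj \<Rightarrow> nat" where
  "ar_s (Tick n) = n"
| "ar_s (ParaL n) = n"
| "ar_s (ParaR n) = n"
| "ar_s (Nu n) = n"
| "ar_s (IotaP n i) = n"
| "ar_s (IotaM n i) = n"
| "ar_s _ = 0"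

fun ar_t :: "cobj \<Rightarrow> nat" where
  "ar_t (Nu n) = Suc n"
| "ar_t c = ar_s c"

fun cedge_src :: "cedge \<Rightarrow> cobj" where
  "cedge_src (Ed n i) = Star"
| "cedge_src (Es c) = Player (ar_s c)"
| "cedge_src (Et c) = Player (ar_t c)"
| "cedge_src (El n) = ParaL n"
| "cedge_src (Er n) = ParaR n"
| "cedge_src (Eeps n i m j) = IotaP n i"
| "cedge_src (Erho n i m j) = IotaM m j"

fun cedge_tgt :: "cedge \<Rightarrow> cobj" where
  "cedge_tgt (Ed n i) = Player n"
| "cedge_tgt (Es c) = c"
| "cedge_tgt (Et c) = c"
| "cedge_tgt (El n) = Para n"
| "cedge_tgt (Er n) = Para n"
| "cedge_tgt (Eeps n i m j) = Tau n i m j"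
| "cedge_tgt (Erho n i m j) = Tau n i m j"

definition base_graph :: "(cobj, cedge) graph" where
  "base_graph = \<lparr>
     verts = {Star} \<union> range Player \<union> basic_objs \<union> range Para \<union>
       {Tau n i m j | n i m j. 1 \<le> i \<and> i \<le> n \<and> 1 \<le> j \<and> j \<le> m},
     edges = {Ed n i | n i. 1 \<le> i \<and> i \<le> n} \<union> Es ` basic_objs \<union> Et ` basic_objs \<union>
       range El \<union> range Er \<union>
       {Eeps n i m j | n i m j. 1 \<le> i \<and> i \<le> n \<and> 1 \<le> j \<and> j \<le> m} \<union>
       {Erho n i m j | n i m j. 1 \<le> i \<and> i \<le> n \<and> 1 \<le> j \<and> j \<le> m},
     esrc = cedge_src, etgt = cedge_tgt\<rparr>"

definition base_rels :: "(cedge list \<times> cedge list) set" where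
  "base_rels =
     {([Ed (ar_s c) i, Es c], [Ed (ar_t c) i, Et c]) | c i.
        c \<in> basic_objs \<and> 1 \<le> i \<and> i \<le> ar_s c} \<union>
     {([Es (ParaL n), El n], [Es (ParaR n), Er n]) | n. True} \<union>
     {([Ed n i, Es (IotaP n i), Eeps n i m j], [Ed m j, Es (IotaM m j), Erho n i m j]) | n i m j.
        1 \<le> i \<and> i \<le> n \<and> 1 \<le> j \<and> j \<le> m}"

type_synonym carr = "cobj \<times> cobj \<times> cedge list set"

definition baseC :: "(cobj, carr) cat" where
  "baseC = presented_cat base_graph base_rels"

abbreviation gen :: "cedge \<Rightarrow> carr" where
  "gen \<equiv> gen_arr base_graph base_rels"

type_synonym 'u elt = "carr + 'u"
type_synonym 'u psh = "(cobj, carr, 'u elt) presheaf"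
type_synonym 'u psh_arr = "(cobj, carr, 'u elt) presheaf_arr"

definition hatC :: "('u psh, 'u psh_arr) cat" where
  "hatC = presheaf_cat baseC"

abbreviation rep :: "cobj \<Rightarrow> 'u psh" where
  "rep \<equiv> yo baseC"

abbreviation rep_arr :: "carr \<Rightarrow> 'u psh_arr" where
  "rep_arr \<equiv> yo_arr baseC"

definition is_position :: "'u psh \<Rightarrow> bool" where
  "is_position X \<longleftrightarrow> X \<in> Ob hatC \<and>
     (\<forall>c\<in>Ob baseC. c \<noteq> Star \<and> c \<notin> range Player \<longrightarrow> onO X c = {}) \<and>
     finite (SIGMA c:Ob baseC. onO X c)"

definition players :: "'u psh \<Rightarrow> (nat \<times> 'u elt) set" where
  "players X = (SIGMA n:UNIV. onO X (Player n))"


section \<open>Moves\<close>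

text \<open>A cospan \<open>A \<rightarrow> M \<leftarrow> B\<close> together with the legs \<open>I \<rightarrow> A\<close> and \<open>I \<rightarrow> B\<close> of its interface.\<close>

datatype 'u move =
  Move (ileg: "'u psh_arr") (sleg: "'u psh_arr") (tleg: "'u psh_arr") (jleg: "'u psh_arr")

definition move_iso :: "'u move \<Rightarrow> 'u move \<Rightarrow> bool" where
  "move_iso m m' \<longleftrightarrow>
     {ileg m', sleg m', tleg m', jleg m'} \<subseteq> Ar hatC \<and>
     (\<exists>\<alpha>I \<alpha>A \<alpha>M \<alpha>B.
        is_iso hatC \<alpha>I \<and> \<alpha>I \<in> hom hatC (Dom hatC (ileg m)) (Dom hatC (ileg m')) \<and>
        is_iso hatC \<alpha>A \<and> \<alpha>A \<in> hom hatC (Dom hatC (sleg m)) (Dom hatC (sleg m')) \<and>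
        is_iso hatC \<alpha>M \<and> \<alpha>M \<in> hom hatC (Cod hatC (sleg m)) (Cod hatC (sleg m')) \<and>
        is_iso hatC \<alpha>B \<and> \<alpha>B \<in> hom hatC (Dom hatC (tleg m)) (Dom hatC (tleg m')) \<and>
        Cod hatC (ileg m') = Dom hatC (sleg m') \<and> Cod hatC (jleg m') = Dom hatC (tleg m') \<and>
        Dom hatC (jleg m') = Dom hatC (ileg m') \<and> Cod hatC (tleg m') = Cod hatC (sleg m') \<and>
        Comp hatC \<alpha>A (ileg m) = Comp hatC (ileg m') \<alpha>I \<and>
        Comp hatC \<alpha>B (jleg m) = Comp hatC (jleg m') \<alpha>I \<and>
        Comp hatC \<alpha>M (sleg m) = Comp hatC (sleg m') \<alpha>A \<and>
        Comp hatC \<alpha>M (tleg m) = Comp hatC (tleg m') \<alpha>B)"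

text \<open>\<open>is_star_copower n I \<kappa>\<close>: \<open>I\<close> is the coproduct \<open>n \<cdot> \<star>\<close> with injections \<open>\<kappa> 1, \<dots>, \<kappa> n\<close>.
  \<open>is_dtuple n k I \<kappa> i\<close>: \<open>i\<close> is the copairing \<open>[d\<^sub>1, \<dots>, d\<^sub>n] : n \<cdot> \<star> \<rightarrow> [k]\<close>.\<close>

definition is_star_copower :: "nat \<Rightarrow> 'u psh \<Rightarrow> (nat \<Rightarrow> 'u psh_arr) \<Rightarrow> bool" where
  "is_star_copower n I \<kappa> \<longleftrightarrow> is_coproduct hatC {1..n} (\<lambda>_. rep Star) I \<kappa>"

definition is_dtuple ::
  "nat \<Rightarrow> nat \<Rightarrow> 'u psh \<Rightarrow> (nat \<Rightarrow> 'u psh_arr) \<Rightarrow> 'u psh_arr \<Rightarrow> bool" where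
  "is_dtuple n k I \<kappa> i \<longleftrightarrow> i \<in> hom hatC I (rep (Player k)) \<and>
     (\<forall>l\<in>{1..n}. Comp hatC i (\<kappa> l) = rep_arr (gen (Ed k l)))"

definition basic_moves :: "'u move set" where
  "basic_moves = {m. \<exists>c\<in>basic_objs. \<exists>I \<kappa> i j.
     is_star_copower (ar_s c) I \<kappa> \<and>
     is_dtuple (ar_s c) (ar_s c) I \<kappa> i \<and> is_dtuple (ar_s c) (ar_t c) I \<kappa> j \<and>
     move_iso (Move i (rep_arr (gen (Es c))) (rep_arr (gen (Et c))) j) m}"

text \<open>The forking move \<open>[n] \<rightarrow> para\<^sub>n \<leftarrow> [n]|[n]\<close>, with source leg \<open>l \<circ> s\<close> and target leg
  \<open>[l \<circ> t, r \<circ> t]\<close>, where \<open>[n]|[n]\<close> is the pushout of \<open>[n] \<leftarrow> n \<cdot> \<star> \<rightarrow> [n]\<close>.\<close>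

definition fork_moves :: "'u move set" where
  "fork_moves = {m. \<exists>n I \<kappa> i p q g.
     is_star_copower n I \<kappa> \<and> is_dtuple n n I \<kappa> i \<and> is_pushout hatC i i p q \<and>
     g \<in> hom hatC (Cod hatC p) (rep (Para n)) \<and>
     Comp hatC g p = rep_arr (Comp baseC (gen (El n)) (gen (Et (ParaL n)))) \<and>
     Comp hatC g q = rep_arr (Comp baseC (gen (Er n)) (gen (Et (ParaR n)))) \<and>
     move_iso
       (Move i (rep_arr (Comp baseC (gen (El n)) (gen (Es (ParaL n))))) g (Comp hatC p i)) m}"

text \<open>The synchronisation move \<open>A \<rightarrow> \<tau> \<leftarrow> A\<close>, with legs \<open>[\<epsilon> \<circ> s, \<rho> \<circ> s]\<close> and
  \<open>[\<epsilon> \<circ> t, \<rho> \<circ> t]\<close>, where \<open>A\<close> glues \<open>[n]\<close> and \<open>[m]\<close> along \<open>d\<^sub>i\<close> and \<open>d\<^sub>j\<close>; the interface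
  glues \<open>n \<cdot> \<star>\<close> and \<open>m \<cdot> \<star>\<close> correspondingly.\<close>

definition sync_moves :: "'u move set" where
  "sync_moves = {mv. \<exists>n i m j I \<kappa> a I' \<kappa>' a' u v p q e f g.
     1 \<le> i \<and> i \<le> n \<and> 1 \<le> j \<and> j \<le> m \<and>
     is_star_copower n I \<kappa> \<and> is_dtuple n n I \<kappa> a \<and>
     is_star_copower m I' \<kappa>' \<and> is_dtuple m m I' \<kappa>' a' \<and>
     is_pushout hatC (\<kappa> i) (\<kappa>' j) u v \<and>
     is_pushout hatC (rep_arr (gen (Ed n i))) (rep_arr (gen (Ed m j))) p q \<and>
     e \<in> hom hatC (Cod hatC u) (Cod hatC p) \<and>
     Comp hatC e u = Comp hatC p a \<and> Comp hatC e v = Comp hatC q a' \<and>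
     f \<in> hom hatC (Cod hatC p) (rep (Tau n i m j)) \<and>
     Comp hatC f p = rep_arr (Comp baseC (gen (Eeps n i m j)) (gen (Es (IotaP n i)))) \<and>
     Comp hatC f q = rep_arr (Comp baseC (gen (Erho n i m j)) (gen (Es (IotaM m j)))) \<and>
     g \<in> hom hatC (Cod hatC p) (rep (Tau n i m j)) \<and>
     Comp hatC g p = rep_arr (Comp baseC (gen (Eeps n i m j)) (gen (Et (IotaP n i)))) \<and>
     Comp hatC g q = rep_arr (Comp baseC (gen (Erho n i m j)) (gen (Et (IotaM m j)))) \<and>
     move_iso (Move e f g e) mv}"

definition all_moves :: "'u move set" where
  "all_moves = basic_moves \<union> fork_moves \<union> sync_moves"

text \<open>\<open>is_extension m f g\<close>: the cospan \<open>f, g\<close> arises from \<open>m\<close> by pushing out along some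
  \<open>z : I \<rightarrow> Z\<close>.\<close>

definition is_extension :: "'u move \<Rightarrow> 'u psh_arr \<Rightarrow> 'u psh_arr \<Rightarrow> bool" where
  "is_extension m f g \<longleftrightarrow> (\<exists>Z z a za w zw b zb.
     is_position Z \<and> z \<in> hom hatC (Dom hatC (ileg m)) Z \<and>
     is_pushout hatC (ileg m) z a za \<and>
     is_pushout hatC (Comp hatC (sleg m) (ileg m)) z w zw \<and>
     is_pushout hatC (jleg m) z b zb \<and>
     f \<in> hom hatC (Cod hatC a) (Cod hatC w) \<and>
     Comp hatC f a = Comp hatC w (sleg m) \<and> Comp hatC f za = zw \<and>
     g \<in> hom hatC (Cod hatC b) (Cod hatC w) \<and>
     Comp hatC g b = Comp hatC w (tleg m) \<and> Comp hatC g zb = zw)"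


section \<open>Plays, views and strategies\<close>

text \<open>\<open>is_chain_play S N u\<close>: \<open>u : X\<^sub>0 \<hookrightarrow> U\<close> is a play given by a chain of \<open>N \<le> \<infinity>\<close> extensions
  of moves in \<open>S\<close>. In the diagram of the chain, \<open>Inl k\<close> stands for \<open>X\<^sub>k\<close> and \<open>Inr k\<close>
  for \<open>M\<^sub>k\<close>.\<close>

definition is_chain_play :: "'u move set \<Rightarrow> enat \<Rightarrow> 'u psh_arr \<Rightarrow> bool" where
  "is_chain_play S N u \<longleftrightarrow> is_mono hatC u \<and> (\<exists>P M f g c.
     (\<forall>k. enat k \<le> N \<longrightarrow> is_position (P k)) \<and>
     (\<forall>k. enat k < N \<longrightarrow>
        f k \<in> hom hatC (P k) (M k) \<and> g k \<in> hom hatC (P (Suc k)) (M k) \<and>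
        (\<exists>m\<in>S. is_extension m (f k) (g k))) \<and>
     is_colimit hatC (Inl ` {k. enat k \<le> N} \<union> Inr ` {k. enat k < N}) (case_sum P M)
       ({(Inl k, f k, Inr k) | k. enat k < N} \<union> {(Inl (Suc k), g k, Inr k) | k. enat k < N})
       (Cod hatC u) c \<and>
     u = c (Inl 0))"

definition is_play :: "'u psh_arr \<Rightarrow> bool" where
  "is_play u \<longleftrightarrow> (\<exists>N. is_chain_play all_moves N u)"

definition is_view :: "'u psh_arr \<Rightarrow> bool" where
  "is_view u \<longleftrightarrow> (\<exists>n. Dom hatC u = rep (Player n)) \<and> (\<exists>N. is_chain_play basic_moves (enat N) u)"

text \<open>Objects of \<open>\<E>\<^sub>X\<close> are pairs \<open>(u, x)\<close> of a play \<open>u : Y \<hookrightarrow> U\<close> and a morphism \<open>x : Y \<rightarrow> X\<close>;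
  arrows carry their source and target.\<close>

type_synonym 'u play_obj = "'u psh_arr \<times> 'u psh_arr"

datatype 'u play_arr =
  PlayArr (psrc: "'u play_obj") (pini: "'u psh_arr") (pmap: "'u psh_arr") (ptgt: "'u play_obj")

definition play_objs :: "'u psh \<Rightarrow> 'u play_obj set" where
  "play_objs X = {(u, x). is_play u \<and> x \<in> hom hatC (Dom hatC u) X}"

definition play_cat :: "'u psh \<Rightarrow> ('u play_obj, 'u play_arr) cat" where
  "play_cat X = \<lparr>
     Ob = play_objs X,
     Ar = {PlayArr (u, x) h k (u', x') | u x h k u' x'.
        (u, x) \<in> play_objs X \<and> (u', x') \<in> play_objs X \<and>
        h \<in> hom hatC (Dom hatC u) (Dom hatC u') \<and> k \<in> hom hatC (Cod hatC u) (Cod hatC u') \<and>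
        Comp hatC k u = Comp hatC u' h \<and> Comp hatC x' h = x},
     Dom = psrc, Cod = ptgt,
     Idn = (\<lambda>(u, x). PlayArr (u, x) (Idn hatC (Dom hatC u)) (Idn hatC (Cod hatC u)) (u, x)),
     Comp = (\<lambda>\<beta> \<alpha>. PlayArr (psrc \<alpha>) (Comp hatC (pini \<beta>) (pini \<alpha>))
        (Comp hatC (pmap \<beta>) (pmap \<alpha>)) (ptgt \<beta>))\<rparr>"

definition view_cat :: "'u psh \<Rightarrow> ('u play_obj, 'u play_arr) cat" where
  "view_cat X = full_subcat (play_cat X) {(u, x). is_view u}"

type_synonym ('u, 's) strat = "('u play_obj, 'u play_arr, 's) presheaf"
type_synonym ('u, 's) strat_cat =
  "(('u, 's) strat, ('u play_obj, 'u play_arr, 's) presheaf_arr) cat"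

definition strategies :: "'u psh \<Rightarrow> ('u, 's) strat_cat" where
  "strategies X = presheaf_cat (view_cat X)"

end

theory Submission
  imports Defs
begin

text \<open>The only arrow \<open>[m] \<rightarrow> [n]\<close> in the base category is the identity (when \<open>m = n\<close>), so by
  Yoneda the same holds between the representables. A view over \<open>X\<close> is a view \<open>[n] \<hookrightarrow> V\<close> with a
  map \<open>[n] \<rightarrow> X\<close>, that is, a player \<open>x \<in> X([n])\<close>, and morphisms of views cannot change the
  player; over \<open>[n]\<close> itself the map is forced to be the identity. Hence the category of views
  over \<open>X\<close> is the coproduct over the players \<open>(n, x)\<close> of the categories of views over \<open>[n]\<close>,
  with injections given by postcomposition with \<open>x : [n] \<rightarrow> X\<close>, and presheaves turn this coproduct
  into a product.\<close>

section \<open>Functor categories\<close>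

lemma homI: "f \<in> Ar K \<Longrightarrow> Dom K f = a \<Longrightarrow> Cod K f = b \<Longrightarrow> f \<in> hom K a b"
  by (simp add: hom_def)

lemma homD:
  assumes "f \<in> hom K a b"
  shows "f \<in> Ar K" "Dom K f = a" "Cod K f = b"
  using assms by (auto simp: hom_def)

lemma Ar_hom: "f \<in> Ar K \<Longrightarrow> f \<in> hom K (Dom K f) (Cod K f)"
  by (simp add: hom_def)

lemma op_cat_simps [simp]:
  "Ob (op_cat K) = Ob K" "Ar (op_cat K) = Ar K" "Dom (op_cat K) = Cod K" "Cod (op_cat K) = Dom K"
  "Idn (op_cat K) = Idn K" "Comp (op_cat K) g f = Comp K f g" "hom (op_cat K) a b = hom K b a"
  by (auto simp: op_cat_def hom_def)

lemma full_subcat_simps [simp]: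
  "Ob (full_subcat K S) = Ob K \<inter> S"
  "Ar (full_subcat K S) = {f \<in> Ar K. Dom K f \<in> S \<and> Cod K f \<in> S}"
  "Dom (full_subcat K S) = Dom K" "Cod (full_subcat K S) = Cod K"
  "Idn (full_subcat K S) = Idn K" "Comp (full_subcat K S) = Comp K"
  by (auto simp: full_subcat_def)

lemma product_cat_simps [simp]:
  "Ob (product_cat I D) = (\<Pi>\<^sub>E i\<in>I. Ob (D i))" "Ar (product_cat I D) = (\<Pi>\<^sub>E i\<in>I. Ar (D i))"
  "Dom (product_cat I D) f = (\<lambda>i\<in>I. Dom (D i) (f i))"
  "Cod (product_cat I D) f = (\<lambda>i\<in>I. Cod (D i) (f i))"
  "Idn (product_cat I D) a = (\<lambda>i\<in>I. Idn (D i) (a i))"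
  "Comp (product_cat I D) g f = (\<lambda>i\<in>I. Comp (D i) (g i) (f i))"
  by (auto simp: product_cat_def)

lemma functor_cat_simps [simp]:
  "Ob (functor_cat K L) = {F. is_functor K L F}" "Ar (functor_cat K L) = {t. is_ntrans K L t}"
  "Dom (functor_cat K L) = nsrc" "Cod (functor_cat K L) = ntgt"
  "Idn (functor_cat K L) F = NTrans F F (\<lambda>a\<in>Ob K. Idn L (onO F a))"
  "Comp (functor_cat K L) t s =
     NTrans (nsrc s) (ntgt t) (\<lambda>a\<in>Ob K. Comp L (ncmp t a) (ncmp s a))"
  by (auto simp: functor_cat_def)

lemma set_cat_simps [simp]:
  "Ob set_cat = UNIV" "Ar set_cat = {f. sfun f \<in> sdom f \<rightarrow>\<^sub>E scod f}"
  "Dom set_cat = sdom" "Cod set_cat = scod"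
  "Idn set_cat A = SetArr A A (\<lambda>x\<in>A. x)"
  "Comp set_cat g f = SetArr (sdom f) (scod g) (compose (sdom f) (sfun g) (sfun f))"
  by (auto simp: set_cat_def)

section \<open>Opposites, full subcategories, products and the category of sets\<close>

lemma category_op_cat:
  assumes "category K"
  shows "category (op_cat K)"
proof -
  interpret category K by fact
  show ?thesis
    by unfold_locales
      (auto simp: dom_Ob cod_Ob idn_hom comp_hom comp_idn_left comp_idn_right comp_assoc)
qed

lemma category_full_subcat:
  assumes "category K"
  shows "category (full_subcat K S)"
proof -
  interpret category K by fact
  have h: "f \<in> hom (full_subcat K S) a b \<longleftrightarrow> f \<in> hom K a b \<and> a \<in> S \<and> b \<in> S" for f a b
    by (auto simp: hom_def)
  show ?thesis
    by unfold_locales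
      (auto simp: h dom_Ob cod_Ob idn_hom comp_hom comp_idn_left comp_idn_right
        intro: comp_assoc)
qed

text \<open>Being objects makes \<open>a\<close> and \<open>b\<close> extensional, and the families
  \<open>Dom\<close> and \<open>Cod\<close> are restricted to \<open>I\<close>; equality of
  endpoints can therefore be tested one component at a time.\<close>

lemma hom_product_cat:
  assumes "a \<in> Ob (product_cat I D)" "b \<in> Ob (product_cat I D)"
  shows "hom (product_cat I D) a b = (\<Pi>\<^sub>E i\<in>I. hom (D i) (a i) (b i))"
proof -
  have "f \<in> hom (product_cat I D) a b \<longleftrightarrow> f \<in> (\<Pi>\<^sub>E i\<in>I. hom (D i) (a i) (b i))" for f
    using assms by (auto simp: hom_def PiE_iff fun_eq_iff extensional_def)
  then show ?thesis by blast
qed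

lemma category_product_cat:
  assumes "\<And>i. i \<in> I \<Longrightarrow> category (D i)"
  shows "category (product_cat I D)"
proof
  note cat = category.dom_Ob[OF assms] category.cod_Ob[OF assms]
  fix f assume "f \<in> Ar (product_cat I D)"
  then show "Dom (product_cat I D) f \<in> Ob (product_cat I D)"
    "Cod (product_cat I D) f \<in> Ob (product_cat I D)"
    by (auto simp: PiE_iff cat)
next
  fix a assume "a \<in> Ob (product_cat I D)"
  then show "Idn (product_cat I D) a \<in> hom (product_cat I D) a a"
    by (auto simp: hom_product_cat PiE_iff category.idn_hom[OF assms])
next
  \<comment> \<open>A morphism is split into components typed in the factors, so that each law can
    be checked in one factor at a time.\<close>
  have P: "a \<in> Ob (product_cat I D)" "b \<in> Ob (product_cat I D)"
    "f \<in> extensional I" "\<And>i. i \<in> I \<Longrightarrow> f i \<in> hom (D i) (a i) (b i)"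
    if "f \<in> hom (product_cat I D) a b" for f a b
  proof -
    show 1: "a \<in> Ob (product_cat I D)" "b \<in> Ob (product_cat I D)"
      using that category.dom_Ob[OF assms] category.cod_Ob[OF assms]
      by (auto simp: hom_def PiE_iff)
    show "f \<in> extensional I" "\<And>i. i \<in> I \<Longrightarrow> f i \<in> hom (D i) (a i) (b i)"
      using that by (auto simp: hom_product_cat[OF 1] PiE_iff)
  qed
  fix f g a b c
  assume f: "f \<in> hom (product_cat I D) a b"
  show "Comp (product_cat I D) f (Idn (product_cat I D) a) = f"
    "Comp (product_cat I D) (Idn (product_cat I D) b) f = f"
    using P(3)[OF f] category.comp_idn_right[OF assms P(4)[OF f]]
      category.comp_idn_left[OF assms P(4)[OF f]]
    by (auto intro!: extensionalityI[where A = I])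
  assume g: "g \<in> hom (product_cat I D) b c"
  show "Comp (product_cat I D) g f \<in> hom (product_cat I D) a c"
    unfolding hom_product_cat[OF P(1)[OF f] P(2)[OF g]]
    using P(4)[OF f] P(4)[OF g] by (auto intro: category.comp_hom[OF assms])
  fix h d assume h: "h \<in> hom (product_cat I D) c d"
  show "Comp (product_cat I D) h (Comp (product_cat I D) g f) =
      Comp (product_cat I D) (Comp (product_cat I D) h g) f"
    using P(4)[OF f] P(4)[OF g] P(4)[OF h]
    by (auto intro!: restrict_ext category.comp_assoc[OF assms])
qed

lemma category_set_cat: "category set_cat"
proof
  fix f g h :: "'a set_arr" and a b c d
  assume f: "f \<in> hom set_cat a b"
  then show "Comp set_cat f (Idn set_cat a) = f" "Comp set_cat (Idn set_cat b) f = f"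
    by (cases f; auto simp: hom_def compose_def PiE_iff fun_eq_iff extensional_def restrict_def)+
  assume g: "g \<in> hom set_cat b c"
  show "Comp set_cat g f \<in> hom set_cat a c"
    using f g by (auto simp: hom_def compose_def)
  assume "h \<in> hom set_cat c d"
  then show "Comp set_cat h (Comp set_cat g f) = Comp set_cat (Comp set_cat h g) f"
    using f g by (auto simp: hom_def compose_def PiE_iff intro!: restrict_ext)
qed (auto simp: hom_def)

section \<open>Functors and natural transformations\<close>

lemma is_functorD:
  assumes "is_functor K L F"
  shows "onO F \<in> extensional (Ob K)" "onA F \<in> extensional (Ar K)"
    "a \<in> Ob K \<Longrightarrow> onO F a \<in> Ob L"
    "f \<in> Ar K \<Longrightarrow> onA F f \<in> Ar L"
    "f \<in> Ar K \<Longrightarrow> Dom L (onA F f) = onO F (Dom K f)"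
    "f \<in> Ar K \<Longrightarrow> Cod L (onA F f) = onO F (Cod K f)"
    "a \<in> Ob K \<Longrightarrow> onA F (Idn K a) = Idn L (onO F a)"
    "f \<in> Ar K \<Longrightarrow> g \<in> Ar K \<Longrightarrow> Dom K g = Cod K f \<Longrightarrow>
       onA F (Comp K g f) = Comp L (onA F g) (onA F f)"
  using assms by (auto simp: is_functor_def PiE_iff hom_def)

lemma is_functorI:
  assumes "onO F \<in> extensional (Ob K)" "onA F \<in> extensional (Ar K)"
    "\<And>a. a \<in> Ob K \<Longrightarrow> onO F a \<in> Ob L"
    "\<And>f. f \<in> Ar K \<Longrightarrow> onA F f \<in> hom L (onO F (Dom K f)) (onO F (Cod K f))"
    "\<And>a. a \<in> Ob K \<Longrightarrow> onA F (Idn K a) = Idn L (onO F a)"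
    "\<And>f g. f \<in> Ar K \<Longrightarrow> g \<in> Ar K \<Longrightarrow> Dom K g = Cod K f \<Longrightarrow>
       onA F (Comp K g f) = Comp L (onA F g) (onA F f)"
  shows "is_functor K L F"
  using assms by (auto simp: is_functor_def PiE_iff hom_def)

lemma is_functor_op_cat: "is_functor K L F \<Longrightarrow> is_functor (op_cat K) (op_cat L) F"
  by (auto simp: is_functor_def)

lemma is_ntransD:
  assumes "is_ntrans K L t"
  shows "is_functor K L (nsrc t)" "is_functor K L (ntgt t)" "ncmp t \<in> extensional (Ob K)"
    "a \<in> Ob K \<Longrightarrow> ncmp t a \<in> hom L (onO (nsrc t) a) (onO (ntgt t) a)"
    "f \<in> Ar K \<Longrightarrow> Comp L (ncmp t (Cod K f)) (onA (nsrc t) f) =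
                Comp L (onA (ntgt t) f) (ncmp t (Dom K f))"
  using assms by (auto simp: is_ntrans_def)

lemma ntrans_eqI:
  assumes "is_ntrans K L t" "is_ntrans K L t'" "nsrc t = nsrc t'" "ntgt t = ntgt t'"
    "\<And>a. a \<in> Ob K \<Longrightarrow> ncmp t a = ncmp t' a"
  shows "t = t'"
  using assms by (intro ntrans.expand) (auto simp: is_ntrans_def intro!: extensionalityI[where A = "Ob K"])

lemma is_ntrans_idn:
  assumes "category K" "category L" "is_functor K L F"
  shows "is_ntrans K L (NTrans F F (\<lambda>a\<in>Ob K. Idn L (onO F a)))"
proof -
  interpret K: category K by fact
  interpret L: category L by fact
  note F = is_functorD[OF assms(3)]
  have "Comp L (Idn L (onO F (Cod K f))) (onA F f) = onA F f \<and>
      Comp L (onA F f) (Idn L (onO F (Dom K f))) = onA F f" if "f \<in> Ar K" for f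
    using L.comp_idn_left[OF homI] L.comp_idn_right[OF homI] F that by auto
  then show ?thesis
    using F by (auto simp: is_ntrans_def assms(3) K.dom_Ob K.cod_Ob L.idn_hom)
qed

text \<open>The naturality squares of \<open>s\<close> and \<open>t\<close> at an arrow are pasted
  along their common edge, the image of the arrow under \<open>ntgt s = nsrc t\<close>.\<close>

lemma is_ntrans_comp:
  assumes "category K" "category L" "is_ntrans K L s" "is_ntrans K L t" "nsrc t = ntgt s"
  shows "is_ntrans K L (NTrans (nsrc s) (ntgt t) (\<lambda>a\<in>Ob K. Comp L (ncmp t a) (ncmp s a)))"
proof -
  interpret K: category K by fact
  interpret L: category L by fact
  note s = is_ntransD[OF assms(3)] and t = is_ntransD[OF assms(4), unfolded assms(5)]
  have "Comp L (Comp L (ncmp t (Cod K f)) (ncmp s (Cod K f))) (onA (nsrc s) f) =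
      Comp L (onA (ntgt t) f) (Comp L (ncmp t (Dom K f)) (ncmp s (Dom K f)))"
    if f: "f \<in> Ar K" for f
  proof -
    have ob: "Dom K f \<in> Ob K" "Cod K f \<in> Ob K" using f K.dom_Ob K.cod_Ob by auto
    have h: "onA F f \<in> hom L (onO F (Dom K f)) (onO F (Cod K f))" if "is_functor K L F" for F
      using that f by (auto simp: is_functor_def)
    note ss = s(4)[OF ob(1)] s(4)[OF ob(2)] and tt = t(4)[OF ob(1)] t(4)[OF ob(2)]
    have "Comp L (Comp L (ncmp t (Cod K f)) (ncmp s (Cod K f))) (onA (nsrc s) f) =
        Comp L (ncmp t (Cod K f)) (Comp L (onA (ntgt s) f) (ncmp s (Dom K f)))"
      using L.comp_assoc[OF h[OF s(1)] ss(2) tt(2)] s(5)[OF f] by simp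
    also have "\<dots> = Comp L (Comp L (onA (ntgt t) f) (ncmp t (Dom K f))) (ncmp s (Dom K f))"
      using L.comp_assoc[OF ss(1) h[OF s(2)] tt(2)] t(5)[OF f] by simp
    also have "\<dots> = Comp L (onA (ntgt t) f) (Comp L (ncmp t (Dom K f)) (ncmp s (Dom K f)))"
      using L.comp_assoc[OF ss(1) tt(1) h[OF t(2)]] by simp
    finally show ?thesis .
  qed
  then show ?thesis
    using s(1) t(2) L.comp_hom[OF s(4) t(4)] by (auto simp: is_ntrans_def K.dom_Ob K.cod_Ob)
qed

lemma category_functor_cat:
  assumes K: "category K" and L: "category L"
  shows "category (functor_cat K L)"
proof
  fix a assume "a \<in> Ob (functor_cat K L)"
  then show "Idn (functor_cat K L) a \<in> hom (functor_cat K L) a a"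
    using is_ntrans_idn[OF K L] by (auto simp: hom_def)
next
  interpret L: category L by fact
  fix f g h a b c d
  assume f: "f \<in> hom (functor_cat K L) a b"
  then have f': "is_ntrans K L f" by (simp add: hom_def)
  note fD = is_ntransD[OF f']
  show "Comp (functor_cat K L) f (Idn (functor_cat K L) a) = f"
    "Comp (functor_cat K L) (Idn (functor_cat K L) b) f = f"
    using f fD by (auto simp: hom_def L.comp_idn_right[OF fD(4)] L.comp_idn_left[OF fD(4)]
        intro!: ntrans.expand extensionalityI[where A = "Ob K"])
  assume g: "g \<in> hom (functor_cat K L) b c"
  show "Comp (functor_cat K L) g f \<in> hom (functor_cat K L) a c"
    using f g is_ntrans_comp[OF K L, of f g] by (auto simp: hom_def)
  assume h: "h \<in> hom (functor_cat K L) c d"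
  show "Comp (functor_cat K L) h (Comp (functor_cat K L) g f) =
      Comp (functor_cat K L) (Comp (functor_cat K L) h g) f"
  proof -
    have fgh: "is_ntrans K L f" "is_ntrans K L g" "is_ntrans K L h" "nsrc g = ntgt f" "nsrc h = ntgt g"
      using f g h by (auto simp: hom_def)
    show ?thesis
      using L.comp_assoc[OF is_ntransD(4)[OF fgh(1)] is_ntransD(4)[OF fgh(2), unfolded fgh]
          is_ntransD(4)[OF fgh(3), unfolded fgh]]
      by (auto intro!: restrict_ext)
  qed
qed (auto simp: is_ntrans_def)

section \<open>Isomorphisms of categories from bijective functors\<close>

text \<open>The set-theoretic inverses of the two bijections form a functor: every object and arrow
  of \<open>L\<close> is an image under \<open>F\<close>, and on images the functor laws of
  \<open>F\<close> can be read backwards.\<close>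

lemma isomorphic_categories_if_bij:
  assumes K: "category K" and L: "category L" and F: "is_functor K L F"
    and O: "bij_betw (onO F) (Ob K) (Ob L)" and A: "bij_betw (onA F) (Ar K) (Ar L)"
  shows "isomorphic_categories K L"
proof -
  interpret K: category K by fact
  interpret L: category L by fact
  note FD = is_functorD[OF F]
  define GO GA where "GO = the_inv_into (Ob K) (onO F)" and "GA = the_inv_into (Ar K) (onA F)"
  have inj: "inj_on (onO F) (Ob K)" "inj_on (onA F) (Ar K)"
    using O A by (auto simp: bij_betw_def)
  have GO: "a \<in> Ob K \<Longrightarrow> GO (onO F a) = a" and GA: "f \<in> Ar K \<Longrightarrow> GA (onA F f) = f" for a f
    using inj by (auto simp: GO_def GA_def the_inv_into_f_f)
  have Ob_L: "\<exists>a\<in>Ob K. b = onO F a" if "b \<in> Ob L" for b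
    using O that by (auto simp: bij_betw_def)
  have Ar_L: "\<exists>f\<in>Ar K. g = onA F f" if "g \<in> Ar L" for g
    using A that by (auto simp: bij_betw_def)
  \<comment> \<open>The restrictions provide the extensionality that \<open>is_functor\<close>
    demands.\<close>
  define G where "G = Fctr (restrict GO (Ob L)) (restrict GA (Ar L))"
  have "is_functor L K G"
  proof (rule is_functorI)
    fix f assume "f \<in> Ar L"
    then obtain g where "g \<in> Ar K" "f = onA F g" using Ar_L by blast
    then show "onA G f \<in> hom K (onO G (Dom L f)) (onO G (Cod L f))"
      by (simp add: G_def FD GO GA K.dom_Ob K.cod_Ob Ar_hom)
  next
    fix b assume "b \<in> Ob L"
    then obtain a where "a \<in> Ob K" "b = onO F a" using Ob_L by blast
    then show "onA G (Idn L b) = Idn K (onO G b)"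
      using K.idn_hom[of a] by (simp add: G_def FD GO GA hom_def flip: FD(7))
  next
    fix b assume "b \<in> Ob L"
    then obtain a where "a \<in> Ob K" "b = onO F a" using Ob_L by blast
    then show "onO G b \<in> Ob K"
      by (simp add: G_def FD GO)
  next
    fix f f' assume ff: "f \<in> Ar L" "f' \<in> Ar L" "Dom L f' = Cod L f"
    then obtain g g' where g: "g \<in> Ar K" "f = onA F g" "g' \<in> Ar K" "f' = onA F g'"
      using Ar_L by metis
    \<comment> \<open>Injectivity of \<open>onO F\<close> lifts composability from the images to the
      arrows of \<open>K\<close>.\<close>
    then have d: "Dom K g' = Cod K g"
      using ff inj(1) by (auto simp: FD inj_on_def K.dom_Ob K.cod_Ob)
    have "Comp K g' g \<in> Ar K"
      using K.comp_hom[OF homI homI] g d by (auto simp: hom_def)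
    then show "onA G (Comp L f' f) = Comp K (onA G f') (onA G f)"
      using g d by (simp add: G_def FD(4) GA flip: FD(8))
  qed (auto simp: G_def)
  moreover have "\<forall>a\<in>Ob K. onO G (onO F a) = a" "\<forall>f\<in>Ar K. onA G (onA F f) = f"
    by (auto simp: G_def FD GO GA)
  moreover have "\<forall>b\<in>Ob L. onO F (onO G b) = b" "\<forall>g\<in>Ar L. onA F (onA G g) = g"
    using Ob_L Ar_L by (force simp: G_def FD GO GA)+
  ultimately show ?thesis
    unfolding isomorphic_categories_def using K L F by blast
qed

section \<open>Functors out of a coproduct of categories\<close>

text \<open>The source category is an explicit argument because a \<open>fctr\<close> does not
  record it, while the composite has to be extensional on its carriers.\<close>

definition fctr_comp ::
  "('o, 'm) cat \<Rightarrow> ('p, 'q, 'r, 's) fctr \<Rightarrow> ('o, 'm, 'p, 'q) fctr \<Rightarrow> ('o, 'm, 'r, 's) fctr" where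
  "fctr_comp K G F = Fctr (\<lambda>a\<in>Ob K. onO G (onO F a)) (\<lambda>f\<in>Ar K. onA G (onA F f))"

text \<open>Together with \<open>fctr_comp\<close> on objects, this is the action of precomposition
  with \<open>F\<close> on functor categories.\<close>

definition whisker ::
  "('o, 'm) cat \<Rightarrow> (('p, 'q, 'r, 's) fctr, 'p, 's) ntrans \<Rightarrow> ('o, 'm, 'p, 'q) fctr \<Rightarrow>
    (('o, 'm, 'r, 's) fctr, 'o, 's) ntrans" where
  "whisker K t F = NTrans (fctr_comp K (nsrc t) F) (fctr_comp K (ntgt t) F)
     (\<lambda>a\<in>Ob K. ncmp t (onO F a))"

lemma is_functor_fctr_comp:
  assumes K: "category K" and F: "is_functor K L F" and G: "is_functor L M G"
  shows "is_functor K M (fctr_comp K G F)"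
proof -
  interpret category K by fact
  note FD = is_functorD[OF F] and GD = is_functorD[OF G]
  have "Comp K g f \<in> Ar K" if "f \<in> Ar K" "g \<in> Ar K" "Dom K g = Cod K f" for f g
    using that comp_hom[OF Ar_hom[of f] homI[of g]] by (auto simp: hom_def)
  then show ?thesis
    by (intro is_functorI)
      (auto simp: fctr_comp_def FD GD dom_Ob cod_Ob homI homD(1)[OF idn_hom])
qed

lemma is_ntrans_whisker:
  assumes K: "category K" and F: "is_functor K L F" and t: "is_ntrans L M t"
  shows "is_ntrans K M (whisker K t F)"
proof -
  interpret category K by fact
  note FD = is_functorD[OF F] and tD = is_ntransD[OF t]
  show ?thesis
    using is_functor_fctr_comp[OF K F tD(1)] is_functor_fctr_comp[OF K F tD(2)] tD(4)[OF FD(3)]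
      tD(5)[OF FD(4)]
    by (auto simp: is_ntrans_def whisker_def)
      (auto simp: fctr_comp_def FD dom_Ob cod_Ob)
qed

section \<open>Coproducts of categories and gluing\<close>

text \<open>The coproduct is described by its injections, which jointly biject the tagged objects
  and arrows of the \<open>D i\<close> with those of \<open>K\<close>. The locale thus applies
  directly to a category given in another form, without first building a disjoint union.\<close>

locale category_coproduct = category K for K :: "('p, 'q) cat" +
  fixes I :: "'i set" and D :: "'i \<Rightarrow> ('o, 'm) cat" and F :: "'i \<Rightarrow> ('o, 'm, 'p, 'q) fctr"
  assumes category_D: "i \<in> I \<Longrightarrow> category (D i)"
    and functor_F: "i \<in> I \<Longrightarrow> is_functor (D i) K (F i)"
    and bij_Ob: "bij_betw (\<lambda>(i, a). onO (F i) a) (SIGMA i:I. Ob (D i)) (Ob K)"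
    and bij_Ar: "bij_betw (\<lambda>(i, f). onA (F i) f) (SIGMA i:I. Ar (D i)) (Ar K)"
begin

lemma Ob_cases:
  assumes "b \<in> Ob K"
  obtains i a where "i \<in> I" "a \<in> Ob (D i)" "b = onO (F i) a"
  using assms unfolding bij_betw_imp_surj_on[OF bij_Ob, symmetric] by auto

lemma Ar_cases:
  assumes "g \<in> Ar K"
  obtains i f where "i \<in> I" "f \<in> Ar (D i)" "g = onA (F i) f"
  using assms unfolding bij_betw_imp_surj_on[OF bij_Ar, symmetric] by auto

lemma Ob_inject:
  assumes "onO (F i) a = onO (F j) b" "i \<in> I" "j \<in> I" "a \<in> Ob (D i)" "b \<in> Ob (D j)"
  shows "i = j \<and> a = b"
  using assms bij_Ob by (fastforce simp: bij_betw_def inj_on_def)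

text \<open>The copairing on objects: the inverse bijection finds the summand and the preimage, and
  \<open>h\<close> acts there. The result type is arbitrary so that the same function serves for
  object parts of functors and for components of transformations.\<close>

definition glue_Ob :: "('i \<Rightarrow> 'o \<Rightarrow> 'c) \<Rightarrow> 'p \<Rightarrow> 'c" where
  "glue_Ob h = (\<lambda>b\<in>Ob K.
     case the_inv_into (SIGMA i:I. Ob (D i)) (\<lambda>(i, a). onO (F i) a) b of (i, a) \<Rightarrow> h i a)"

definition glue_Ar :: "('i \<Rightarrow> 'm \<Rightarrow> 'c) \<Rightarrow> 'q \<Rightarrow> 'c" where
  "glue_Ar h = (\<lambda>g\<in>Ar K.
     case the_inv_into (SIGMA i:I. Ar (D i)) (\<lambda>(i, f). onA (F i) f) g of (i, f) \<Rightarrow> h i f)"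

lemma glue_Ob [simp]:
  assumes "i \<in> I" "a \<in> Ob (D i)"
  shows "glue_Ob h (onO (F i) a) = h i a"
proof -
  have "the_inv_into (SIGMA i:I. Ob (D i)) (\<lambda>(i, a). onO (F i) a) (onO (F i) a) = (i, a)"
    using the_inv_into_f_f[OF bij_betw_imp_inj_on[OF bij_Ob], of "(i, a)"] assms by simp
  then show ?thesis
    using is_functorD(3)[OF functor_F] assms by (simp add: glue_Ob_def)
qed

lemma glue_Ar [simp]:
  assumes "i \<in> I" "f \<in> Ar (D i)"
  shows "glue_Ar h (onA (F i) f) = h i f"
proof -
  have "the_inv_into (SIGMA i:I. Ar (D i)) (\<lambda>(i, f). onA (F i) f) (onA (F i) f) = (i, f)"
    using the_inv_into_f_f[OF bij_betw_imp_inj_on[OF bij_Ar], of "(i, f)"] assms by simp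
  then show ?thesis
    using is_functorD(4)[OF functor_F] assms by (simp add: glue_Ar_def)
qed

lemma glue_extensional [simp]:
  "glue_Ob h \<in> extensional (Ob K)" "glue_Ar h' \<in> extensional (Ar K)"
  by (auto simp: glue_Ob_def glue_Ar_def)

definition glue_fctr :: "('i \<Rightarrow> ('o, 'm, 'r, 's) fctr) \<Rightarrow> ('p, 'q, 'r, 's) fctr" where
  "glue_fctr G = Fctr (glue_Ob (\<lambda>i. onO (G i))) (glue_Ar (\<lambda>i. onA (G i)))"

definition glue_ntrans ::
  "('i \<Rightarrow> (('o, 'm, 'r, 's) fctr, 'o, 's) ntrans) \<Rightarrow> (('p, 'q, 'r, 's) fctr, 'p, 's) ntrans" where
  "glue_ntrans t = NTrans (glue_fctr (\<lambda>i. nsrc (t i))) (glue_fctr (\<lambda>i. ntgt (t i)))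
     (glue_Ob (\<lambda>i. ncmp (t i)))"

text \<open>Composable arrows come from a single summand, so each functor law for the glued map is
  the corresponding law of one \<open>G i\<close>.\<close>

lemma is_functor_glue_fctr:
  assumes G: "\<And>i. i \<in> I \<Longrightarrow> is_functor (D i) L (G i)"
  shows "is_functor K L (glue_fctr G)"
proof (rule is_functorI)
  fix a assume "a \<in> Ob K"
  then obtain i b where b: "i \<in> I" "b \<in> Ob (D i)" "a = onO (F i) b" by (rule Ob_cases)
  then show "onO (glue_fctr G) a \<in> Ob L"
    using is_functorD(3)[OF G] by (simp add: glue_fctr_def)
  show "onA (glue_fctr G) (Idn K a) = Idn L (onO (glue_fctr G) a)"
    using b is_functorD(7)[OF functor_F[OF b(1)] b(2)] is_functorD(7)[OF G[OF b(1)] b(2)]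
      homD(1)[OF category.idn_hom[OF category_D[OF b(1)] b(2)]]
    by (simp add: glue_fctr_def flip: is_functorD(7)[OF functor_F])
next
  fix f assume "f \<in> Ar K"
  then obtain i g where g: "i \<in> I" "g \<in> Ar (D i)" "f = onA (F i) g" by (rule Ar_cases)
  interpret D: category "D i" by (rule category_D[OF g(1)])
  note Gi = is_functorD[OF G[OF g(1)]] and Fi = is_functorD[OF functor_F[OF g(1)]]
  show "onA (glue_fctr G) f \<in>
      hom L (onO (glue_fctr G) (Dom K f)) (onO (glue_fctr G) (Cod K f))"
    using g by (auto simp: glue_fctr_def Fi Gi D.dom_Ob D.cod_Ob intro: homI)
  fix f' assume "f' \<in> Ar K" and d: "Dom K f' = Cod K f"
  then obtain j g' where g': "j \<in> I" "g' \<in> Ar (D j)" "f' = onA (F j) g'" using Ar_cases by blast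
  note Fj = is_functorD[OF functor_F[OF g'(1)]]
  \<comment> \<open>The object shared by the two arrows lies in the images of both
    \<open>F j\<close> and \<open>F i\<close>, and objects of different summands have different
    images.\<close>
  have "j = i \<and> Dom (D j) g' = Cod (D i) g"
    using d g g' by (intro Ob_inject)
      (auto simp: Fi Fj D.cod_Ob category.dom_Ob[OF category_D[OF g'(1)]])
  then have [simp]: "j = i" and d': "Dom (D i) g' = Cod (D i) g" by auto
  have "Comp (D i) g' g \<in> Ar (D i)"
    using D.comp_hom[OF Ar_hom[of g] homI[of g']] g g' d' by (auto simp: hom_def)
  then show "onA (glue_fctr G) (Comp K f' f) =
      Comp L (onA (glue_fctr G) f') (onA (glue_fctr G) f)"
    using g g' d' by (simp add: glue_fctr_def Gi flip: Fi(8))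
qed (auto simp: glue_fctr_def)

text \<open>An arrow and both its endpoints lie in the image of one summand, so its naturality
  square is a square of one \<open>t i\<close>.\<close>

lemma is_ntrans_glue_ntrans:
  assumes t: "\<And>i. i \<in> I \<Longrightarrow> is_ntrans (D i) L (t i)"
  shows "is_ntrans K L (glue_ntrans t)"
proof -
  have "ncmp (glue_ntrans t) a \<in> hom L (onO (nsrc (glue_ntrans t)) a) (onO (ntgt (glue_ntrans t)) a)"
    if "a \<in> Ob K" for a
    using that is_ntransD(4)[OF t]
    by (auto elim!: Ob_cases simp: glue_ntrans_def glue_fctr_def)
  moreover have "Comp L (ncmp (glue_ntrans t) (Cod K f)) (onA (nsrc (glue_ntrans t)) f) =
      Comp L (onA (ntgt (glue_ntrans t)) f) (ncmp (glue_ntrans t) (Dom K f))"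
    if "f \<in> Ar K" for f
  proof -
    obtain i g where g: "i \<in> I" "g \<in> Ar (D i)" "f = onA (F i) g" using Ar_cases \<open>f \<in> Ar K\<close> .
    then show ?thesis
      using is_functorD(5,6)[OF functor_F[OF g(1)] g(2)] is_ntransD(5)[OF t[OF g(1)] g(2)]
        category.dom_Ob[OF category_D[OF g(1)] g(2)] category.cod_Ob[OF category_D[OF g(1)] g(2)]
      by (auto simp: glue_ntrans_def glue_fctr_def)
  qed
  ultimately show ?thesis
    using is_functor_glue_fctr[OF is_ntransD(1)[OF t]] is_functor_glue_fctr[OF is_ntransD(2)[OF t]]
    by (auto simp: is_ntrans_def) (auto simp: glue_ntrans_def)
qed

text \<open>Existence half of the universal property of the coproduct.\<close>

lemma fctr_comp_glue_fctr:
  assumes "i \<in> I" "is_functor (D i) L (G i)"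
  shows "fctr_comp (D i) (glue_fctr G) (F i) = G i"
  using assms is_functorD[OF assms(2)]
  by (auto simp: fctr_comp_def glue_fctr_def
      intro!: fctr.expand extensionalityI[where A = "Ob (D i)"] extensionalityI[where A = "Ar (D i)"])

lemma whisker_glue_ntrans:
  assumes "i \<in> I" "is_ntrans (D i) L (t i)"
  shows "whisker (D i) (glue_ntrans t) (F i) = t i"
  using assms is_ntransD[OF assms(2)]
  by (auto simp: whisker_def glue_ntrans_def fctr_comp_glue_fctr[where G = "\<lambda>i. nsrc (t i)"]
      fctr_comp_glue_fctr[where G = "\<lambda>i. ntgt (t i)"]
      intro!: ntrans.expand extensionalityI[where A = "Ob (D i)"])

text \<open>Uniqueness half of the universal property: the injections jointly reach every object and
  arrow of \<open>K\<close>, and extensionality fixes the values elsewhere.\<close>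

lemma fctr_comp_inject:
  assumes G: "is_functor K L G" and H: "is_functor K L H"
    and eq: "\<And>i. i \<in> I \<Longrightarrow> fctr_comp (D i) G (F i) = fctr_comp (D i) H (F i)"
  shows "G = H"
proof (intro fctr.expand conjI)
  show "onO G = onO H"
  proof (rule extensionalityI[OF is_functorD(1)[OF G] is_functorD(1)[OF H]])
    fix b assume "b \<in> Ob K"
    then show "onO G b = onO H b"
      using eq by (auto elim!: Ob_cases simp: fctr_comp_def restrict_def fun_eq_iff) metis
  qed
  show "onA G = onA H"
  proof (rule extensionalityI[OF is_functorD(2)[OF G] is_functorD(2)[OF H]])
    fix b assume "b \<in> Ar K"
    then show "onA G b = onA H b"
      using eq by (auto elim!: Ar_cases simp: fctr_comp_def restrict_def fun_eq_iff) metis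
  qed
qed

text \<open>A whiskered transformation carries its whiskered endpoints, so
  \<open>fctr_comp_inject\<close> settles source and target; the components agree because every
  object lies in some summand.\<close>

lemma whisker_inject:
  assumes s: "is_ntrans K L s" and t: "is_ntrans K L t"
    and eq: "\<And>i. i \<in> I \<Longrightarrow> whisker (D i) s (F i) = whisker (D i) t (F i)"
  shows "s = t"
proof (rule ntrans_eqI[OF s t])
  show "nsrc s = nsrc t" "ntgt s = ntgt t"
    using eq is_ntransD[OF s] is_ntransD[OF t]
    by (auto simp: whisker_def intro: fctr_comp_inject)
  fix a assume "a \<in> Ob K"
  then show "ncmp s a = ncmp t a"
    using eq by (auto elim!: Ob_cases simp: whisker_def restrict_def fun_eq_iff) metis
qed

text \<open>Functors out of a coproduct are families of functors. Precomposition with the injections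
  is bijective on functors and on transformations: gluing gives surjectivity, and the joint
  surjectivity of the injections gives injectivity.\<close>

theorem isomorphic_functor_cat:
  assumes L: "category L"
  shows "isomorphic_categories (functor_cat K L) (product_cat I (\<lambda>i. functor_cat (D i) L))"
proof -
  let ?K = "functor_cat K L" and ?P = "product_cat I (\<lambda>i. functor_cat (D i) L)"
  define \<Phi> where "\<Phi> = Fctr (\<lambda>G\<in>Ob ?K. \<lambda>i\<in>I. fctr_comp (D i) G (F i))
    (\<lambda>t\<in>Ar ?K. \<lambda>i\<in>I. whisker (D i) t (F i))"
  have K: "category ?K"
    using category_functor_cat[OF category_axioms L] .
  have P: "category ?P"
    using category_functor_cat[OF category_D L] by (rule category_product_cat)
  have ob: "onO (F i) a \<in> Ob K" if "i \<in> I" "a \<in> Ob (D i)" for i a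
    using is_functorD(3)[OF functor_F] that by blast
  have \<Phi>_Ob: "onO \<Phi> G \<in> Ob ?P" if "G \<in> Ob ?K" for G
    using that is_functor_fctr_comp[OF category_D functor_F] by (auto simp: \<Phi>_def)
  have \<Phi>_Ar: "onA \<Phi> t \<in> Ar ?P" if "t \<in> Ar ?K" for t
    using that is_ntrans_whisker[OF category_D functor_F] by (auto simp: \<Phi>_def)
  have "is_functor ?K ?P \<Phi>"
  proof (rule is_functorI)
    fix t assume t: "t \<in> Ar ?K"
    with \<Phi>_Ar[OF t] show "onA \<Phi> t \<in> hom ?P (onO \<Phi> (Dom ?K t)) (onO \<Phi> (Cod ?K t))"
      by (intro homI) (auto simp: \<Phi>_def whisker_def is_ntransD intro!: restrict_ext)
    fix s assume s: "s \<in> Ar ?K" "Dom ?K s = Cod ?K t"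
    with t show "onA \<Phi> (Comp ?K s t) = Comp ?P (onA \<Phi> s) (onA \<Phi> t)"
      using is_ntrans_comp[OF category_axioms L, of t s]
      by (auto simp: \<Phi>_def whisker_def ob intro!: restrict_ext)
  next
    fix G assume G: "G \<in> Ob ?K"
    with \<Phi>_Ob show "onO \<Phi> G \<in> Ob ?P" by blast
    from G show "onA \<Phi> (Idn ?K G) = Idn ?P (onO \<Phi> G)"
      using is_ntrans_idn[OF category_axioms L, of G]
      by (auto simp: \<Phi>_def whisker_def fctr_comp_def ob intro!: restrict_ext)
  qed (auto simp: \<Phi>_def)
  moreover have "bij_betw (onO \<Phi>) (Ob ?K) (Ob ?P)"
    unfolding bij_betw_def
  proof (intro conjI inj_onI set_eqI iffI)
    fix G H assume *: "G \<in> Ob ?K" "H \<in> Ob ?K" "onO \<Phi> G = onO \<Phi> H"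
    have "fctr_comp (D i) G (F i) = fctr_comp (D i) H (F i)" if "i \<in> I" for i
      using fun_cong[OF *(3), of i] *(1,2) that by (simp add: \<Phi>_def)
    with * show "G = H"
      by (intro fctr_comp_inject) auto
  next
    fix G assume G: "G \<in> Ob ?P"
    then have g: "\<And>i. i \<in> I \<Longrightarrow> is_functor (D i) L (G i)" by auto
    have "onO \<Phi> (glue_fctr G) = G"
      using G is_functor_glue_fctr[OF g] fctr_comp_glue_fctr[where G = G, OF _ g]
      by (auto simp: \<Phi>_def PiE_iff intro!: extensionalityI[where A = I])
    then show "G \<in> onO \<Phi> ` Ob ?K"
      using is_functor_glue_fctr[OF g] by (metis functor_cat_simps(1) imageI mem_Collect_eq)
  qed (use \<Phi>_Ob in blast)
  moreover have "bij_betw (onA \<Phi>) (Ar ?K) (Ar ?P)"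
    unfolding bij_betw_def
  proof (intro conjI inj_onI set_eqI iffI)
    fix s t assume *: "s \<in> Ar ?K" "t \<in> Ar ?K" "onA \<Phi> s = onA \<Phi> t"
    have "whisker (D i) s (F i) = whisker (D i) t (F i)" if "i \<in> I" for i
      using fun_cong[OF *(3), of i] *(1,2) that by (simp add: \<Phi>_def)
    with * show "s = t"
      by (intro whisker_inject) auto
  next
    fix t assume t: "t \<in> Ar ?P"
    then have g: "\<And>i. i \<in> I \<Longrightarrow> is_ntrans (D i) L (t i)" by auto
    have "onA \<Phi> (glue_ntrans t) = t"
      using t is_ntrans_glue_ntrans[OF g] whisker_glue_ntrans[where t = t, OF _ g]
      by (auto simp: \<Phi>_def PiE_iff intro!: extensionalityI[where A = I])
    then show "t \<in> onA \<Phi> ` Ar ?K"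
      using is_ntrans_glue_ntrans[OF g] by (metis functor_cat_simps(2) imageI mem_Collect_eq)
  qed (use \<Phi>_Ar in blast)
  ultimately show ?thesis
    using isomorphic_categories_if_bij[OF K P] by blast
qed

end

text \<open>Opposites have the same carriers and the same injections, hence the same two bijections.
  Presheaves are functors on the opposite category, so the coproduct is wanted there.\<close>

lemma category_coproduct_op_cat:
  assumes "category_coproduct K I D F"
  shows "category_coproduct (op_cat K) I (\<lambda>i. op_cat (D i)) F"
proof -
  interpret category_coproduct K I D F by fact
  interpret op: category "op_cat K" by (rule category_op_cat[OF category_axioms])
  show ?thesis
    using category_op_cat[OF category_D] is_functor_op_cat[OF functor_F] bij_Ob bij_Ar
    by (intro category_coproduct.intro category_coproduct_axioms.intro op.category_axioms) auto
qed

section \<open>Presented categories\<close>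

lemma is_path_verts: "is_path G a p b \<Longrightarrow> a \<in> verts G \<and> b \<in> verts G"
  by (induction p arbitrary: a) auto

lemma is_path_append: "is_path G a p b \<Longrightarrow> is_path G b q c \<Longrightarrow> is_path G a (p @ q) c"
  by (induction p arbitrary: a) auto

lemma presented_cat_simps [simp]:
  "Ob (presented_cat G R) = verts G"
  "Ar (presented_cat G R) = {path_class G R a b p | a b p. is_path G a p b}"
  "Dom (presented_cat G R) (path_class G R a b p) = a"
  "Cod (presented_cat G R) (path_class G R a b p) = b"
  "Idn (presented_cat G R) a = path_class G R a a []"
  by (auto simp: presented_cat_def path_class_def)

lemma hom_presented_cat:
  "hom (presented_cat G R) a b = {path_class G R a b p | p. is_path G a p b}"
  by (force simp: hom_def)

text \<open>Composition is defined through all pairs of representatives; since the congruence is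
  closed under concatenation, the single pair \<open>p\<close>, \<open>q\<close> stands for all of
  them.\<close>

lemma Comp_presented_cat [simp]:
  assumes "is_path G a p b" "is_path G b q c"
  shows "Comp (presented_cat G R) (path_class G R b c q) (path_class G R a b p) =
    path_class G R a c (p @ q)"
proof -
  have "(\<exists>p'. path_cong G R a b p p' \<and> (\<exists>q'. path_cong G R b c q q' \<and> path_cong G R a c (p' @ q') r))
      \<longleftrightarrow> path_cong G R a c (p @ q) r" for r
    using assms by (meson path_cong.refl path_cong.trans path_cong.append)
  then show ?thesis
    by (auto simp: presented_cat_def path_class_def)
qed

lemma category_presented_cat: "category (presented_cat G R)"
proof
  fix f g h a b c d
  assume "f \<in> hom (presented_cat G R) a b"
  then obtain p where p: "is_path G a p b" "f = path_class G R a b p"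
    by (auto simp: hom_presented_cat)
  have v: "is_path G a [] a" "is_path G b [] b"
    using is_path_verts[OF p(1)] by auto
  show "Comp (presented_cat G R) f (Idn (presented_cat G R) a) = f"
    "Comp (presented_cat G R) (Idn (presented_cat G R) b) f = f"
    using p Comp_presented_cat[OF v(1) p(1)] Comp_presented_cat[OF p(1) v(2)] by simp_all
  assume "g \<in> hom (presented_cat G R) b c"
  then obtain q where q: "is_path G b q c" "g = path_class G R b c q"
    by (auto simp: hom_presented_cat)
  show "Comp (presented_cat G R) g f \<in> hom (presented_cat G R) a c"
    using p q is_path_append[OF p(1) q(1)] by (auto simp: hom_presented_cat)
  assume "h \<in> hom (presented_cat G R) c d"
  then obtain r where r: "is_path G c r d" "h = path_class G R c d r"
    by (auto simp: hom_presented_cat)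
  show "Comp (presented_cat G R) h (Comp (presented_cat G R) g f) =
      Comp (presented_cat G R) (Comp (presented_cat G R) h g) f"
    using p q r is_path_append[OF p(1) q(1)] is_path_append[OF q(1) r(1)] by simp
qed (auto simp: hom_presented_cat dest: is_path_verts)

section \<open>Arrows between players in the base category\<close>

text \<open>Edges out of a player end in basic objects, no edge ends in \<open>Star\<close>, and an
  edge ending in a player starts in \<open>Star\<close>. A nonempty path that leaves a player
  therefore never reaches a player again.\<close>

lemma is_path_Player_Player:
  assumes "is_path base_graph (Player m) p (Player n)"
  shows "m = n \<and> p = []"
proof -
  \<comment> \<open>The objects other than \<open>Star\<close> and the players are closed under
    following edges.\<close>
  have step: "b \<notin> insert Star (range Player)"
    if "is_path base_graph a p b" "a \<notin> insert Star (range Player)" for a b p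
    using that
  proof (induction p arbitrary: a)
    case (Cons e es)
    then have "cedge_tgt e \<notin> insert Star (range Player)"
      by (cases e) (auto simp: base_graph_def basic_objs_def)
    with Cons show ?case by (auto simp: base_graph_def)
  qed auto
  show ?thesis
  proof (cases p)
    case (Cons e es)
    then have "cedge_tgt e \<notin> insert Star (range Player)"
      "is_path base_graph (cedge_tgt e) es (Player n)"
      using assms by (cases e; auto simp: base_graph_def basic_objs_def)+
    with step show ?thesis by blast
  qed (use assms in auto)
qed

lemma category_baseC: "category baseC"
  unfolding baseC_def by (rule category_presented_cat)

lemma Player_Ob_baseC: "Player n \<in> Ob baseC"
  by (simp add: baseC_def base_graph_def)

lemma hom_baseC_Player:
  "hom baseC (Player m) (Player n) = (if m = n then {Idn baseC (Player n)} else {})"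
proof -
  have "is_path base_graph (Player n) [] (Player n)"
    by (simp add: base_graph_def)
  then show ?thesis
    by (auto simp: baseC_def hom_presented_cat dest: is_path_Player_Player)
qed

section \<open>The Yoneda lemma\<close>

text \<open>The functor laws are associativity and the unit law of \<open>K\<close>;
  \<open>Inl\<close> and \<open>projl\<close> only translate between arrows and elements.\<close>

lemma is_functor_yo:
  assumes "category K" "a \<in> Ob K"
  shows "is_functor (op_cat K) set_cat (yo K a)"
proof -
  interpret category K by fact
  have c: "Comp K g f \<in> Ar K" "Dom K (Comp K g f) = Dom K f" "Cod K (Comp K g f) = Cod K g"
    if "f \<in> Ar K" "g \<in> Ar K" "Dom K g = Cod K f" for f g
    using that comp_hom[OF Ar_hom[of f] homI[of g]] by (auto simp: hom_def)
  show ?thesis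
  proof (rule is_functorI)
    fix f assume f: "f \<in> Ar (op_cat K)"
    then show "onA (yo K a) f \<in>
        hom set_cat (onO (yo K a) (Dom (op_cat K) f)) (onO (yo K a) (Cod (op_cat K) f))"
      using comp_hom[OF Ar_hom[of f]]
      by (auto simp: yo_def hom_def[of set_cat] dom_Ob cod_Ob)
    fix g assume g: "g \<in> Ar (op_cat K)" "Dom (op_cat K) g = Cod (op_cat K) f"
    then show "onA (yo K a) (Comp (op_cat K) g f) =
        Comp set_cat (onA (yo K a) g) (onA (yo K a) f)"
      using f c[of g f] comp_hom[OF Ar_hom[of f]] comp_assoc[OF Ar_hom[of g] homI[of f]]
      by (auto simp: yo_def compose_def intro!: restrict_ext)
  next
    fix c assume "c \<in> Ob (op_cat K)"
    then show "onA (yo K a) (Idn (op_cat K) c) = Idn set_cat (onO (yo K a) c)"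
      using idn_hom[of c] homD[OF idn_hom[of c]]
      by (auto simp: yo_def comp_idn_right intro!: restrict_ext)
  qed (auto simp: yo_def)
qed

text \<open>The inverse of evaluation at the identity of \<open>a\<close>: an arrow into
  \<open>a\<close> is sent to the restriction of \<open>x\<close> along it.\<close>

definition yoneda_arr ::
  "('o, 'm) cat \<Rightarrow> 'o \<Rightarrow> ('o, 'm, 'm + 'u) presheaf \<Rightarrow> 'm + 'u \<Rightarrow> ('o, 'm, 'm + 'u) presheaf_arr" where
  "yoneda_arr K a X x = NTrans (yo K a) X
     (\<lambda>c\<in>Ob K. SetArr (Inl ` hom K c a) (onO X c)
       (\<lambda>e\<in>Inl ` hom K c a. sfun (onA X (projl e)) x))"

text \<open>Functor laws in \<open>set_cat\<close> are equations between functions with recorded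
  domain and codomain. Here they become equations between elements, in the order that contravariance
  imposes.\<close>

lemma presheaf_sfun:
  assumes "is_functor (op_cat K) set_cat X" "f \<in> hom K b a"
  shows "sdom (onA X f) = onO X a" "scod (onA X f) = onO X b"
    "x \<in> onO X a \<Longrightarrow> sfun (onA X f) x \<in> onO X b"
    "g \<in> hom K c b \<Longrightarrow> x \<in> onO X a \<Longrightarrow>
       sfun (onA X (Comp K f g)) x = sfun (onA X g) (sfun (onA X f) x)"
    "a \<in> Ob K \<Longrightarrow> x \<in> onO X a \<Longrightarrow> sfun (onA X (Idn K a)) x = x"
proof -
  note X = is_functorD[OF assms(1)] and f = homD[OF assms(2)]
  show 1: "sdom (onA X f) = onO X a" "scod (onA X f) = onO X b"
    using X(5,6)[of f] f by auto
  show "x \<in> onO X a \<Longrightarrow> sfun (onA X f) x \<in> onO X b"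
    using X(4)[of f] f 1 by auto
  show "g \<in> hom K c b \<Longrightarrow> x \<in> onO X a \<Longrightarrow>
      sfun (onA X (Comp K f g)) x = sfun (onA X g) (sfun (onA X f) x)"
    using X(8)[of f g] f 1 by (auto simp: compose_def hom_def)
  show "a \<in> Ob K \<Longrightarrow> x \<in> onO X a \<Longrightarrow> sfun (onA X (Idn K a)) x = x"
    using X(7)[of a] by simp
qed

text \<open>The Yoneda lemma: by naturality a transformation out of \<open>yo K a\<close> is
  determined by its value at the identity of \<open>a\<close>, and every element of \<open>X\<close>
  over \<open>a\<close> occurs as such a value.\<close>

lemma bij_betw_yoneda_arr:
  assumes K: "category K" and a: "a \<in> Ob K" and X: "X \<in> Ob (presheaf_cat K)"
  shows "bij_betw (yoneda_arr K a X) (onO X a) (hom (presheaf_cat K) (yo K a) X)"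
proof -
  interpret category K by fact
  have X': "is_functor (op_cat K) set_cat X"
    using X by (simp add: presheaf_cat_def)
  note psh = presheaf_sfun[OF X'] and yo = is_functor_yo[OF K a]
  have "inj_on (yoneda_arr K a X) (onO X a)"
  proof (rule inj_onI)
    fix x y assume *: "x \<in> onO X a" "y \<in> onO X a" "yoneda_arr K a X x = yoneda_arr K a X y"
    \<comment> \<open>Evaluation at the identity recovers the element.\<close>
    have "sfun (ncmp (yoneda_arr K a X z) a) (Inl (Idn K a)) = z" if "z \<in> onO X a" for z
      using that a idn_hom[OF a] psh(5)[OF idn_hom[OF a]] by (simp add: yoneda_arr_def)
    with * show "x = y" by metis
  qed
  moreover have "yoneda_arr K a X x \<in> hom (presheaf_cat K) (yo K a) X" if x: "x \<in> onO X a" for x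
  proof -
    have "is_ntrans (op_cat K) set_cat (yoneda_arr K a X x)"
      unfolding is_ntrans_def
    proof (intro conjI ballI)
      fix c assume c: "c \<in> Ob (op_cat K)"
      then show "ncmp (yoneda_arr K a X x) c \<in>
          hom set_cat (onO (nsrc (yoneda_arr K a X x)) c) (onO (ntgt (yoneda_arr K a X x)) c)"
        using x psh(3) by (auto simp: yoneda_arr_def yo_def hom_def[of set_cat])
    next
      fix f assume f: "f \<in> Ar (op_cat K)"
      then show "Comp set_cat (ncmp (yoneda_arr K a X x) (Cod (op_cat K) f))
            (onA (nsrc (yoneda_arr K a X x)) f) =
          Comp set_cat (onA (ntgt (yoneda_arr K a X x)) f)
            (ncmp (yoneda_arr K a X x) (Dom (op_cat K) f))"
        using x psh(2)[OF Ar_hom[of f]] psh(4)[OF _ Ar_hom[of f]] comp_hom[OF Ar_hom[of f]]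
        by (auto simp: yoneda_arr_def yo_def dom_Ob cod_Ob compose_def intro!: restrict_ext)
    qed (use yo X' in \<open>auto simp: yoneda_arr_def\<close>)
    then show ?thesis
      by (auto simp: presheaf_cat_def hom_def yoneda_arr_def)
  qed
  moreover have "\<exists>x\<in>onO X a. t = yoneda_arr K a X x"
    if t: "t \<in> hom (presheaf_cat K) (yo K a) X" for t
  proof -
    have t': "is_ntrans (op_cat K) set_cat t" "nsrc t = yo K a" "ntgt t = X"
      using t by (auto simp: presheaf_cat_def hom_def)
    note tD = is_ntransD[OF t'(1), unfolded t'(2,3)]
    define x where "x = sfun (ncmp t a) (Inl (Idn K a))"
    have t_hom: "sdom (ncmp t c) = Inl ` hom K c a" "scod (ncmp t c) = onO X c"
      "sfun (ncmp t c) \<in> Inl ` hom K c a \<rightarrow>\<^sub>E onO X c" if "c \<in> Ob K" for c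
      using tD(4)[of c] that by (auto simp: hom_def[of set_cat] yo_def)
    have x: "x \<in> onO X a"
      using t_hom(3)[OF a] idn_hom[OF a] by (auto simp: x_def)
    have "sfun (ncmp t c) (Inl f) = sfun (onA X f) x" if f: "f \<in> hom K c a" for c f
    proof -
      note f' = homD[OF f]
      \<comment> \<open>The naturality square along \<open>f\<close> is evaluated at the identity of
        \<open>a\<close>: one side turns the identity into \<open>f\<close> and then applies
        \<open>t\<close>, the other restricts \<open>x\<close> along \<open>f\<close>.\<close>
      have *: "sfun (Comp set_cat (ncmp t c) (onA (yo K a) f)) (Inl (Idn K a)) =
          sfun (Comp set_cat (onA X f) (ncmp t a)) (Inl (Idn K a))"
        using tD(5)[of f] f' by (simp del: set_cat_simps)
      then show ?thesis
        using f' idn_hom[OF a] t_hom(1)[OF a] comp_idn_left[OF f]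
        by (simp add: yo_def compose_def x_def)
    qed
    then have "ncmp t c = ncmp (yoneda_arr K a X x) c" if "c \<in> Ob K" for c
      using that t_hom[OF that]
      by (intro set_arr.expand)
        (auto simp: yoneda_arr_def PiE_iff intro!: extensionalityI[where A = "Inl ` hom K c a"])
    then have "t = yoneda_arr K a X x"
      using t' tD(3)
      by (intro ntrans.expand)
        (auto simp: yoneda_arr_def intro!: extensionalityI[where A = "Ob K"])
    with x show ?thesis by blast
  qed
  ultimately show ?thesis
    by (auto simp: bij_betw_def)
qed

lemma category_presheaf_cat: "category K \<Longrightarrow> category (presheaf_cat K)"
  unfolding presheaf_cat_def by (intro category_functor_cat category_op_cat category_set_cat)

section \<open>Views over a position\<close>

lemma category_hatC: "category hatC"
  unfolding hatC_def by (intro category_presheaf_cat category_baseC)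

lemma rep_Ob_hatC: "rep (Player n) \<in> Ob hatC"
  using is_functor_yo[OF category_baseC Player_Ob_baseC]
  by (simp add: hatC_def presheaf_cat_def)

text \<open>By Yoneda these morphisms biject with the elements of \<open>rep (Player n)\<close> over
  \<open>Player m\<close>, which are the arrows between the two players in the base
  category.\<close>

lemma hom_hatC_rep_Player:
  "hom hatC (rep (Player m)) (rep (Player n) :: 'u psh) =
    (if m = n then {Idn hatC (rep (Player n))} else {})"
proof -
  let ?N = "rep (Player n) :: 'u psh"
  have bij: "bij_betw (yoneda_arr baseC (Player m) ?N) (onO ?N (Player m))
      (hom hatC (rep (Player m)) ?N)"
    using bij_betw_yoneda_arr[OF category_baseC Player_Ob_baseC rep_Ob_hatC[unfolded hatC_def]]
    by (simp add: hatC_def)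
  have val: "onO ?N (Player m) = Inl ` hom baseC (Player m) (Player n)"
    using Player_Ob_baseC by (simp add: yo_def)
  show ?thesis
  proof (cases "m = n")
    case True
    have "onO ?N (Player m) = {Inl (Idn baseC (Player n))}"
      unfolding val by (simp add: True hom_baseC_Player)
    then have "\<exists>t. hom hatC (rep (Player m)) ?N = {t}"
      using bij by (auto simp: bij_betw_def)
    \<comment> \<open>The identity is a morphism of this type, hence the only one.\<close>
    moreover have "Idn hatC ?N \<in> hom hatC ?N ?N"
      by (intro category.idn_hom[OF category_hatC] rep_Ob_hatC)
    ultimately show ?thesis
      using True by auto
  next
    case False
    then have "onO ?N (Player m) = {}"
      by (simp add: val hom_baseC_Player)
    with bij False show ?thesis
      by (auto simp: bij_betw_def)
  qed
qed

text \<open>Equality of the presheaves would identify an empty set of morphisms with one that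
  contains an identity. This allows \<open>n\<close> to be read off the domain of a view.\<close>

lemma rep_Player_inject:
  assumes "(rep (Player m) :: 'u psh) = rep (Player n)"
  shows "m = n"
proof (rule ccontr)
  assume "m \<noteq> n"
  then have "hom hatC (rep (Player m) :: 'u psh) (rep (Player n)) = {}"
    by (simp add: hom_hatC_rep_Player)
  moreover have "hom hatC (rep (Player n) :: 'u psh) (rep (Player n)) \<noteq> {}"
    by (simp add: hom_hatC_rep_Player)
  ultimately show False using assms by simp
qed

section \<open>The categories of plays and of views over a presheaf\<close>

lemma play_cat_simps [simp]:
  "Ob (play_cat X) = play_objs X" "Dom (play_cat X) = psrc" "Cod (play_cat X) = ptgt"
  "Idn (play_cat X) (u, x) =
     PlayArr (u, x) (Idn hatC (Dom hatC u)) (Idn hatC (Cod hatC u)) (u, x)"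
  "Comp (play_cat X) \<beta> \<alpha> = PlayArr (psrc \<alpha>) (Comp hatC (pini \<beta>) (pini \<alpha>))
     (Comp hatC (pmap \<beta>) (pmap \<alpha>)) (ptgt \<beta>)"
  by (auto simp: play_cat_def)

lemma PlayArr_in_Ar_play_cat [simp]:
  "PlayArr (u, x) h k (u', x') \<in> Ar (play_cat X) \<longleftrightarrow>
     (u, x) \<in> play_objs X \<and> (u', x') \<in> play_objs X \<and>
     h \<in> hom hatC (Dom hatC u) (Dom hatC u') \<and> k \<in> hom hatC (Cod hatC u) (Cod hatC u') \<and>
     Comp hatC k u = Comp hatC u' h \<and> Comp hatC x' h = x"
  by (auto simp: play_cat_def)

lemma is_play_Ar: "is_play u \<Longrightarrow> u \<in> Ar hatC"
  by (auto simp: is_play_def is_chain_play_def is_mono_def)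

lemma category_play_cat: "category (play_cat (X :: 'u psh))"
proof
  fix \<alpha> :: "'u play_arr" assume "\<alpha> \<in> Ar (play_cat X)"
  then show "Dom (play_cat X) \<alpha> \<in> Ob (play_cat X)" "Cod (play_cat X) \<alpha> \<in> Ob (play_cat X)"
    by (auto simp: play_cat_def)
next
  interpret hat: category "hatC :: ('u psh, 'u psh_arr) cat" by (rule category_hatC)
  fix a assume a: "a \<in> Ob (play_cat X)"
  then obtain u x where [simp]: "a = (u, x)" by (cases a)
  have u: "u \<in> Ar hatC" "x \<in> hom hatC (Dom hatC u) X"
    using a is_play_Ar by (auto simp: play_objs_def)
  then show "Idn (play_cat X) a \<in> hom (play_cat X) a a"
    using a by (intro homI)
      (auto simp: hat.idn_hom hat.dom_Ob hat.cod_Ob hat.comp_idn_left[OF Ar_hom]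
        hat.comp_idn_right[OF Ar_hom] hat.comp_idn_right)
next
  interpret hat: category "hatC :: ('u psh, 'u psh_arr) cat" by (rule category_hatC)
  fix \<alpha> \<beta> \<gamma> :: "'u play_arr" and a b c d :: "'u play_obj"
  \<comment> \<open>Unpacking an arrow once reduces the remaining laws to laws of
    \<open>hatC\<close> for the two maps \<open>h\<close> and \<open>k\<close>.\<close>
  have E: "\<exists>u x h k u' x'. \<alpha> = PlayArr (u, x) h k (u', x') \<and> a = (u, x) \<and> b = (u', x') \<and>
      u \<in> hom hatC (Dom hatC u) (Cod hatC u) \<and> u' \<in> hom hatC (Dom hatC u') (Cod hatC u') \<and>
      x \<in> hom hatC (Dom hatC u) X \<and> x' \<in> hom hatC (Dom hatC u') X \<and>
      (u, x) \<in> play_objs X \<and> (u', x') \<in> play_objs X \<and>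
      h \<in> hom hatC (Dom hatC u) (Dom hatC u') \<and> k \<in> hom hatC (Cod hatC u) (Cod hatC u') \<and>
      Comp hatC k u = Comp hatC u' h \<and> Comp hatC x' h = x"
    if "\<alpha> \<in> hom (play_cat X) a b" for \<alpha> :: "'u play_arr" and a b
    using that
    by (cases \<alpha>; cases a; cases b)
      (auto simp: hom_def[of "play_cat X"] play_objs_def intro: is_play_Ar Ar_hom)
  assume "\<alpha> \<in> hom (play_cat X) a b"
  from E[OF this] obtain u x h k u' x' where
    [simp]: "\<alpha> = PlayArr (u, x) h k (u', x')" "a = (u, x)" "b = (u', x')" and
    A: "u \<in> hom hatC (Dom hatC u) (Cod hatC u)" "u' \<in> hom hatC (Dom hatC u') (Cod hatC u')"
      "x \<in> hom hatC (Dom hatC u) X" "x' \<in> hom hatC (Dom hatC u') X"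
      "(u, x) \<in> play_objs X" "(u', x') \<in> play_objs X"
      "h \<in> hom hatC (Dom hatC u) (Dom hatC u')" "k \<in> hom hatC (Cod hatC u) (Cod hatC u')"
      "Comp hatC k u = Comp hatC u' h" "Comp hatC x' h = x"
    by blast
  show "Comp (play_cat X) \<alpha> (Idn (play_cat X) a) = \<alpha>"
    "Comp (play_cat X) (Idn (play_cat X) b) \<alpha> = \<alpha>"
    using A by (simp_all add: hat.comp_idn_right hat.comp_idn_left)
  assume "\<beta> \<in> hom (play_cat X) b c"
  from E[OF this] obtain h' k' u'' x'' where
    [simp]: "\<beta> = PlayArr (u', x') h' k' (u'', x'')" "c = (u'', x'')" and
    B: "u'' \<in> hom hatC (Dom hatC u'') (Cod hatC u'')" "x'' \<in> hom hatC (Dom hatC u'') X"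
      "(u'', x'') \<in> play_objs X"
      "h' \<in> hom hatC (Dom hatC u') (Dom hatC u'')" "k' \<in> hom hatC (Cod hatC u') (Cod hatC u'')"
      "Comp hatC k' u' = Comp hatC u'' h'" "Comp hatC x'' h' = x'"
    by auto
  \<comment> \<open>The commuting squares of the two arrows are pasted along
    \<open>u'\<close>.\<close>
  have "Comp hatC (Comp hatC k' k) u = Comp hatC u'' (Comp hatC h' h)"
    using hat.comp_assoc[OF A(1) A(8) B(5)] hat.comp_assoc[OF A(7) A(2) B(5)]
      hat.comp_assoc[OF A(7) B(4) B(1)] A(9) B(6) by simp
  moreover have "Comp hatC x'' (Comp hatC h' h) = x"
    using hat.comp_assoc[OF A(7) B(4) B(2)] A(10) B(7) by simp
  ultimately show "Comp (play_cat X) \<beta> \<alpha> \<in> hom (play_cat X) a c"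
    using A B hat.comp_hom[OF A(7) B(4)] hat.comp_hom[OF A(8) B(5)]
    by (auto simp: hom_def[of "play_cat X"])
  assume "\<gamma> \<in> hom (play_cat X) c d"
  from E[OF this] obtain h'' k'' u''' x''' where
    [simp]: "\<gamma> = PlayArr (u'', x'') h'' k'' (u''', x''')" and
    C: "h'' \<in> hom hatC (Dom hatC u'') (Dom hatC u''')" "k'' \<in> hom hatC (Cod hatC u'') (Cod hatC u''')"
    by auto
  show "Comp (play_cat X) \<gamma> (Comp (play_cat X) \<beta> \<alpha>) =
      Comp (play_cat X) (Comp (play_cat X) \<gamma> \<beta>) \<alpha>"
    using hat.comp_assoc[OF A(7) B(4) C(1)] hat.comp_assoc[OF A(8) B(5) C(2)] by simp
qed

lemma category_view_cat: "category (view_cat X)"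
  unfolding view_cat_def by (intro category_full_subcat category_play_cat)

section \<open>Change of base for views\<close>

definition post_obj :: "'u psh_arr \<Rightarrow> 'u play_obj \<Rightarrow> 'u play_obj" where
  "post_obj z = (\<lambda>(u, y). (u, Comp hatC z y))"

text \<open>The plays and both maps of a morphism stay the same; only the map from the initial
  position is followed by \<open>z\<close>. The source category is recovered from
  \<open>Dom hatC z\<close>.\<close>

definition post_fctr ::
  "'u psh_arr \<Rightarrow> ('u play_obj, 'u play_arr, 'u play_obj, 'u play_arr) fctr" where
  "post_fctr z = Fctr (\<lambda>a\<in>Ob (view_cat (Dom hatC z)). post_obj z a)
     (\<lambda>\<alpha>\<in>Ar (view_cat (Dom hatC z)).
        PlayArr (post_obj z (psrc \<alpha>)) (pini \<alpha>) (pmap \<alpha>) (post_obj z (ptgt \<alpha>)))"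

lemma view_cat_simps [simp]:
  "Dom (view_cat X) = psrc" "Cod (view_cat X) = ptgt"
  "Idn (view_cat X) (u, x) =
     PlayArr (u, x) (Idn hatC (Dom hatC u)) (Idn hatC (Cod hatC u)) (u, x)"
  "Comp (view_cat X) \<beta> \<alpha> = PlayArr (psrc \<alpha>) (Comp hatC (pini \<beta>) (pini \<alpha>))
     (Comp hatC (pmap \<beta>) (pmap \<alpha>)) (ptgt \<beta>)"
  by (auto simp: view_cat_def)

lemma Ob_view_cat_iff [simp]:
  "(u, x) \<in> Ob (view_cat X) \<longleftrightarrow> is_play u \<and> is_view u \<and> x \<in> hom hatC (Dom hatC u) X"
  by (auto simp: view_cat_def play_objs_def)

lemma Ar_view_cat_iff [simp]:
  "PlayArr (u, x) h k (u', x') \<in> Ar (view_cat X) \<longleftrightarrow>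
     (u, x) \<in> Ob (view_cat X) \<and> (u', x') \<in> Ob (view_cat X) \<and>
     h \<in> hom hatC (Dom hatC u) (Dom hatC u') \<and> k \<in> hom hatC (Cod hatC u) (Cod hatC u') \<and>
     Comp hatC k u = Comp hatC u' h \<and> Comp hatC x' h = x"
  by (auto simp: view_cat_def)

text \<open>Associativity turns the triangle over \<open>Y\<close> that belongs to an arrow into a
  triangle over \<open>X\<close>; the square of plays is carried over as it is.\<close>

lemma is_functor_post_fctr:
  assumes z: "z \<in> hom hatC Y X"
  shows "is_functor (view_cat Y) (view_cat X) (post_fctr z)"
proof -
  interpret hat: category hatC by (rule category_hatC)
  interpret view: category "view_cat Y" by (rule category_view_cat)
  have [simp]: "Dom hatC z = Y" using z by (rule homD)
  have ob: "post_obj z a \<in> Ob (view_cat X)" if "a \<in> Ob (view_cat Y)" for a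
    using that hat.comp_hom[OF _ z] by (cases a) (auto simp: post_obj_def)
  show ?thesis
  proof (rule is_functorI)
    fix a assume a: "a \<in> Ob (view_cat Y)"
    then show "onO (post_fctr z) a \<in> Ob (view_cat X)"
      by (simp add: post_fctr_def ob)
    show "onA (post_fctr z) (Idn (view_cat Y) a) = Idn (view_cat X) (onO (post_fctr z) a)"
      using a homD(1)[OF view.idn_hom[OF a]]
      by (cases a) (auto simp: post_fctr_def post_obj_def simp del: Ar_view_cat_iff)
  next
    fix \<alpha> assume \<alpha>: "\<alpha> \<in> Ar (view_cat Y)"
    obtain u x h k u' x' where [simp]: "\<alpha> = PlayArr (u, x) h k (u', x')"
      by (cases \<alpha>) auto
    show "onA (post_fctr z) \<alpha> \<in> hom (view_cat X) (onO (post_fctr z) (Dom (view_cat Y) \<alpha>))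
        (onO (post_fctr z) (Cod (view_cat Y) \<alpha>))"
      using \<alpha> hat.comp_assoc[OF _ _ z, of h _ _ x'] hat.comp_hom[OF _ z]
      by (auto simp: post_fctr_def post_obj_def hom_def[of "view_cat X"])
    fix \<beta> assume \<beta>: "\<beta> \<in> Ar (view_cat Y)" "Dom (view_cat Y) \<beta> = Cod (view_cat Y) \<alpha>"
    then have "Comp (view_cat Y) \<beta> \<alpha> \<in> Ar (view_cat Y)"
      using view.comp_hom[OF Ar_hom[OF \<alpha>] homI[of \<beta>]] by (auto simp: hom_def[of "view_cat Y"])
    then show "onA (post_fctr z) (Comp (view_cat Y) \<beta> \<alpha>) =
        Comp (view_cat X) (onA (post_fctr z) \<beta>) (onA (post_fctr z) \<alpha>)"
      using \<alpha> \<beta> by (simp add: post_fctr_def del: Ar_view_cat_iff)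
  qed (auto simp: post_fctr_def)
qed

text \<open>The domain of a view is some \<open>rep (Player m)\<close>, and a morphism from it to
  \<open>rep (Player n)\<close> exists only for \<open>m = n\<close>, where it is the
  identity.\<close>

lemma Ob_view_cat_rep_Player:
  "(u, v) \<in> Ob (view_cat (rep (Player n))) \<longleftrightarrow>
     is_play u \<and> is_view u \<and> Dom hatC u = rep (Player n) \<and> v = Idn hatC (rep (Player n))"
proof -
  have "Dom hatC u = rep (Player n) \<and> v = Idn hatC (rep (Player n))"
    if "is_view u" "v \<in> hom hatC (Dom hatC u) (rep (Player n))"
    using that by (auto simp: is_view_def hom_hatC_rep_Player split: if_splits)
  then show ?thesis
    by (auto simp: hom_hatC_rep_Player)
qed

text \<open>The summand at \<open>(n, x)\<close> is embedded by postcomposition with the Yoneda map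
  of \<open>x\<close>. Joint bijectivity on objects comes from Yoneda, on arrows from the rigidity
  of morphisms between representable players.\<close>

lemma category_coproduct_view_cat:
  fixes X :: "'u psh"
  assumes X: "X \<in> Ob hatC"
  shows "category_coproduct (view_cat X) (players X) (\<lambda>(n, x). view_cat (rep (Player n)))
    (\<lambda>(n, x). post_fctr (yoneda_arr baseC (Player n) X x))"
proof -
  interpret hat: category "hatC :: ('u psh, 'u psh_arr) cat" by (rule category_hatC)
  define y where "y = (\<lambda>(n, x). yoneda_arr baseC (Player n) X x)"
  let ?V = "\<lambda>i. view_cat (rep (Player (fst i))) :: ('u play_obj, 'u play_arr) cat"
    and ?F = "\<lambda>i. post_fctr (y i)" and ?id = "\<lambda>n. Idn hatC (rep (Player n)) :: 'u psh_arr"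
  have y_bij: "bij_betw (\<lambda>x. y (n, x)) (onO X (Player n)) (hom hatC (rep (Player n)) X)" for n
    using bij_betw_yoneda_arr[OF category_baseC Player_Ob_baseC X[unfolded hatC_def]]
    by (simp add: y_def hatC_def)
  have y_hom: "y i \<in> hom hatC (rep (Player (fst i))) X" if "i \<in> players X" for i
    using that bij_betwE[OF y_bij] by (cases i) (auto simp: players_def)
  have y_inj: "x = x'"
    if "(n, x) \<in> players X" "(n, x') \<in> players X" "y (n, x) = y (n, x')" for n x x'
    using that bij_betw_imp_inj_on[OF y_bij[of n]] by (auto simp: players_def inj_on_def)
  have y_surj: "\<exists>x. (n, x) \<in> players X \<and> z = y (n, x)" if "z \<in> hom hatC (rep (Player n)) X" for n z
    using that bij_betw_imp_surj_on[OF y_bij[of n]] by (auto simp: players_def)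
  \<comment> \<open>Over a representable player the map \<open>v\<close> is an identity, so
    postcomposition leaves exactly \<open>y i\<close>.\<close>
  have post_obj: "post_obj (y i) (u, v) = (u, y i)"
    if "i \<in> players X" "(u, v) \<in> Ob (?V i)" for i u v
    using that hat.comp_idn_right[OF y_hom[OF that(1)]]
    by (simp add: post_obj_def Ob_view_cat_rep_Player del: Ob_view_cat_iff)
  have F_Ob: "onO (?F i) a = post_obj (y i) a" if "i \<in> players X" "a \<in> Ob (?V i)" for i a
    using that homD(2)[OF y_hom] by (simp add: post_fctr_def)
  have F_Ar: "onA (?F i) \<alpha> = PlayArr (post_obj (y i) (psrc \<alpha>)) (pini \<alpha>) (pmap \<alpha>)
      (post_obj (y i) (ptgt \<alpha>))" if "i \<in> players X" "\<alpha> \<in> Ar (?V i)" for i \<alpha>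
    using that homD(2)[OF y_hom] by (simp add: post_fctr_def)
  have F: "is_functor (?V i) (view_cat X) (?F i)" if "i \<in> players X" for i
    by (rule is_functor_post_fctr[OF y_hom[OF that]])
  have V_dom: "psrc \<alpha> \<in> Ob (?V i)" "ptgt \<alpha> \<in> Ob (?V i)" if "\<alpha> \<in> Ar (?V i)" for i \<alpha>
    using that category.dom_Ob[OF category_view_cat] category.cod_Ob[OF category_view_cat]
    by fastforce+
  \<comment> \<open>The common play determines \<open>n\<close> through its domain, and the common
    map to \<open>X\<close> then determines \<open>x\<close> because the Yoneda map is
    injective.\<close>
  have post_inj: "i = j \<and> a = b"
    if "post_obj (y i) a = post_obj (y j) b" "i \<in> players X" "j \<in> players X"
      "a \<in> Ob (?V i)" "b \<in> Ob (?V j)" for i j a b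
  proof -
    obtain n x m x' u v u' v' where
      [simp]: "i = (n, x)" "j = (m, x')" "a = (u, v)" "b = (u', v')"
      by (metis surj_pair)
    have eq: "u = u'" "y i = y j"
      using that post_obj by auto
    have uv: "Dom hatC u = rep (Player n)" "v = ?id n" "Dom hatC u' = rep (Player m)" "v' = ?id m"
      using that by (auto simp: Ob_view_cat_rep_Player simp del: Ob_view_cat_iff)
    have "n = m"
      using uv eq rep_Player_inject by metis
    with eq uv that y_inj show ?thesis by auto
  qed
  have "bij_betw (\<lambda>(i, a). onO (?F i) a) (SIGMA i:players X. Ob (?V i)) (Ob (view_cat X))"
    unfolding bij_betw_def
  proof (intro conjI subset_antisym subsetI)
    show "inj_on (\<lambda>(i, a). onO (?F i) a) (SIGMA i:players X. Ob (?V i))"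
      using post_inj by (force simp: inj_on_def F_Ob)
  next
    fix a assume "a \<in> Ob (view_cat X)"
    then obtain u z where a: "a = (u, z)" "is_play u" "is_view u" "z \<in> hom hatC (Dom hatC u) X"
      by (cases a) auto
    then obtain n where n: "Dom hatC u = rep (Player n)" by (auto simp: is_view_def)
    with a y_surj obtain x where x: "(n, x) \<in> players X" "z = y (n, x)" by metis
    \<comment> \<open>The preimage keeps the play and takes the identity as its map to the base;
      \<open>z\<close> is restored by \<open>y (n, x)\<close>.\<close>
    have "(u, ?id n) \<in> Ob (?V (n, x))"
      using a n by (simp add: Ob_view_cat_rep_Player del: Ob_view_cat_iff)
    with x a show "a \<in> (\<lambda>(i, a). onO (?F i) a) ` (SIGMA i:players X. Ob (?V i))"
      by (intro image_eqI[where x = "((n, x), (u, ?id n))"]) (simp_all add: F_Ob post_obj del: Ob_view_cat_iff)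
  qed (use is_functorD(3)[OF F] in auto)
  moreover have "bij_betw (\<lambda>(i, \<alpha>). onA (?F i) \<alpha>) (SIGMA i:players X. Ar (?V i)) (Ar (view_cat X))"
    unfolding bij_betw_def
  proof (intro conjI subset_antisym subsetI)
    \<comment> \<open>The image of an arrow retains its two maps, and its endpoints are recovered by
      injectivity on objects.\<close>
    have "i = j \<and> \<alpha> = \<beta>" if "onA (?F i) \<alpha> = onA (?F j) \<beta>" "i \<in> players X" "j \<in> players X"
      "\<alpha> \<in> Ar (?V i)" "\<beta> \<in> Ar (?V j)" for i j \<alpha> \<beta>
      using that post_inj[OF _ that(2,3) V_dom(1)[OF that(4)] V_dom(1)[OF that(5)]]
        post_inj[OF _ that(2,3) V_dom(2)[OF that(4)] V_dom(2)[OF that(5)]]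
      by (auto simp: F_Ar intro: play_arr.expand)
    then show "inj_on (\<lambda>(i, \<alpha>). onA (?F i) \<alpha>) (SIGMA i:players X. Ar (?V i))"
      by (force simp: inj_on_def)
  next
    fix \<alpha> assume \<alpha>: "\<alpha> \<in> Ar (view_cat X)"
    obtain u z h k u' z' where \<alpha>_eq: "\<alpha> = PlayArr (u, z) h k (u', z')"
      by (cases \<alpha>) auto
    note arr = \<alpha>[unfolded \<alpha>_eq Ar_view_cat_iff Ob_view_cat_iff]
    obtain n n' where n: "Dom hatC u = rep (Player n)" "Dom hatC u' = rep (Player n')"
      using arr by (auto simp: is_view_def)
    \<comment> \<open>The map \<open>h\<close> runs between representables of players, so it can
      only be an identity.\<close>
    have h: "n' = n" "h = ?id n"
      using arr by (auto simp: n hom_hatC_rep_Player split: if_splits)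
    \<comment> \<open>With \<open>h\<close> an identity, the triangle over \<open>X\<close> says
      that both views belong to the same player.\<close>
    have z: "z' = z"
      using arr hat.comp_idn_right[of z'] by (auto simp: n h)
    obtain x where x: "(n, x) \<in> players X" "z = y (n, x)"
      using arr n y_surj by metis
    \<comment> \<open>The preimage has the same underlying maps, now between views whose maps to the
      base are identities.\<close>
    let ?\<alpha> = "PlayArr (u, ?id n) h k (u', ?id n)"
    have ob: "(u, ?id n) \<in> Ob (?V (n, x))" "(u', ?id n) \<in> Ob (?V (n, x))"
      using arr n h by (auto simp: Ob_view_cat_rep_Player simp del: Ob_view_cat_iff)
    have "Comp hatC (?id n) (?id n) = ?id n"
      by (rule hat.comp_idn_right[OF hat.idn_hom[OF rep_Ob_hatC]])
    then have "?\<alpha> \<in> Ar (?V (n, x))"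
      using ob arr h by (simp del: Ob_view_cat_iff)
    then show "\<alpha> \<in> (\<lambda>(i, \<alpha>). onA (?F i) \<alpha>) ` (SIGMA i:players X. Ar (?V i))"
      using x z ob
      by (intro image_eqI[where x = "((n, x), ?\<alpha>)"])
        (simp_all add: F_Ar post_obj \<alpha>_eq del: Ar_view_cat_iff Ob_view_cat_iff)
  qed (use is_functorD(4)[OF F] in auto)
  ultimately have "category_coproduct (view_cat X) (players X) ?V ?F"
    using F by (intro category_coproduct.intro category_coproduct_axioms.intro category_view_cat)
  then show ?thesis
    by (simp add: y_def case_prod_unfold)
qed

section \<open>Strategies as a product over the players\<close>

theorem mainTheorem3:
  fixes X :: "'u psh"
  assumes "is_position X"
  shows "isomorphic_categories
    (strategies X :: ('u, 's) strat_cat)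
    (product_cat (players X) (\<lambda>(n, x). strategies (rep (Player n)) :: ('u, 's) strat_cat))"
proof -
  have "X \<in> Ob hatC"
    using assms by (simp add: is_position_def)
  \<comment> \<open>Strategies are functors on the opposite of the view category, so the coproduct
    is moved to opposites before functors into \<open>set_cat\<close> are taken.\<close>
  note category_coproduct_op_cat[OF category_coproduct_view_cat[OF this]]
  from category_coproduct.isomorphic_functor_cat[OF this category_set_cat]
  show ?thesis
    by (simp add: strategies_def presheaf_cat_def case_prod_unfold)
qed

end
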